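(* Let $A_N$ and $B_N$ be independent $N\times N$ random matrices, each sampled from the Gaussian Orthogonal Ensemble, let $\{A_N,B_N\}=A_NB_N+B_NA_N$, and let $$M_{2m}=\lim_{N\to\infty}\frac{1}{N^{2m+1}}\mathbb{E}\left[\mathrm{Tr}\left(\{A_N,B_N\}^{2m}\right)\right].$$ Then for every positive integer $m$, $$M_{2m}=\frac{1}{m}\sum_{k=1}^m 2^k\binom{2m}{k-1}\binom{m}{k}.$$
   Context: The $N\times N$ Gaussian Orthogonal Ensemble (GOE) consists of real symmetric matrices $(a_{ij})$ whose entries $a_{ij}$, $i\le j$, are independent with $a_{ij}=a_{ji}\sim N(0,1)$ for $i\neq j$ and $a_{ii}\sim N(0,2)$. The quantity $M_{2m}$ is called the limiting expected $2m$-th moment of $\{\mathrm{GOE},\mathrm{GOE}\}$; it is the limit of the expected $2m$-th moment of the empirical spectral distribution of $\{A_N,B_N\}/N$. *)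

theory Defs
  imports "HOL-Probability.Probability" "Jordan_Normal_Form.Matrix"
begin

definition mat_trace :: "'a::comm_monoid_add mat \<Rightarrow> 'a" where
  "mat_trace X = (\<Sum>i<dim_row X. X $$ (i, i))"

definition anticommutator :: "'a::semiring_0 mat \<Rightarrow> 'a mat \<Rightarrow> 'a mat" where
  "anticommutator X Y = X * Y + Y * X"

(* The Borel sigma-algebra of the space of real N x N matrices, i.e. the one generated by the
   N^2 entry functions.  It is pulled back from the product space because the type of matrices
   contains matrices of all sizes and carries no topology. *)
definition mat_borel :: "nat \<Rightarrow> real mat measure" where
  "mat_borel N = vimage_algebra (carrier_mat N N)
     (\<lambda>X. \<lambda>ij\<in>{..<N} \<times> {..<N}. X $$ ij)
     (PiM ({..<N} \<times> {..<N}) (\<lambda>_. borel))"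

(* The second argument of normal_density is the standard deviation: the diagonal entries have
   variance 2, the off-diagonal ones variance 1. *)
definition GOE :: "'w measure \<Rightarrow> nat \<Rightarrow> ('w \<Rightarrow> real mat) \<Rightarrow> bool" where
  "GOE P N A \<longleftrightarrow>
     prob_space P \<and>
     (\<forall>\<omega>\<in>space P. A \<omega> \<in> carrier_mat N N \<and> transpose_mat (A \<omega>) = A \<omega>) \<and>
     prob_space.indep_vars P (\<lambda>_. borel) (\<lambda>(i, j) \<omega>. A \<omega> $$ (i, j)) {(i, j). i \<le> j \<and> j < N} \<and>
     (\<forall>i<N. distributed P lborel (\<lambda>\<omega>. A \<omega> $$ (i, i)) (normal_density 0 (sqrt 2))) \<and>
     (\<forall>i j. i < j \<and> j < N \<longrightarrow> distributed P lborel (\<lambda>\<omega>. A \<omega> $$ (i, j)) (normal_density 0 1))"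

end

theory Submission
  imports Defs "HOL-Computational_Algebra.Formal_Power_Series"
begin

text \<open>
Expanding \<open>(A B + B A) ^ n\<close> gives the sum, over all words made of \<open>n\<close> blocks \<open>A B\<close> or \<open>B A\<close>, of
the corresponding matrix products. The proof determines the limit of the normalised expected
trace of every word in \<open>A\<close> and \<open>B\<close> and then adds up these limits.

For the limit, Gaussian integration by parts applied to the first letter of a trace expresses the
expectation of a product of traces through expectations of products with two letters less
(\<open>loop_equation\<close>). After normalisation only the terms in which a trace splits into two survive, so
by induction on the number of letters the expectation of a product of traces tends to the product
of the numbers of noncrossing pairings of the words that match equal letters
(\<open>loop_equation_limit\<close>). Working with products of traces from the start makes a separate
concentration argument unnecessary. The integration by parts formula for monomials in the entries
reduces, by independence, to the recursion of the moments of a normal variable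
(\<open>gaussian_matrices_GOE\<close>).

For the sum, let \<open>F\<close> be the generating function, in the number of blocks, of the number of
noncrossing pairings of block words. Cutting a word at the partner of its first letter leads to a
system of recurrences that involves block words framed by one further letter at either end, and
parity removes all other cases. Elimination gives \<open>F = 1 + X\<^sup>2 (F\<^sup>2 + F\<^sup>3)\<close> (\<open>moment_fps_cubic\<close>). With
\<open>F = 1 + Z\<close> and \<open>y = X\<^sup>2\<close> this is \<open>Z = y (1 + Z)\<^sup>2 (2 + Z)\<close>, and Lagrange inversion gives the coefficient
of \<open>y ^ m\<close> as \<open>1 / m\<close> times that of \<open>z ^ (m - 1)\<close> in \<open>(1 + z) ^ (2 m) (2 + z) ^ m\<close>
(\<open>moment_seq_formula\<close>).
\<close>

section \<open>Noncrossing pairings of words\<close>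

text \<open>The list of all pairs \<open>(u, v)\<close> with \<open>w = u @ c # v\<close>, one for each occurrence of the letter
\<open>c\<close> in the word \<open>w\<close>.\<close>

fun splits :: "'a \<Rightarrow> 'a list \<Rightarrow> ('a list \<times> 'a list) list" where
  "splits c [] = []"
| "splits c (d # w) =
     (if c = d then [([], w)] else []) @ map (\<lambda>(u, v). (d # u, v)) (splits c w)"

lemma splits_decomp: "(u, v) \<in> set (splits c w) \<longleftrightarrow> w = u @ c # v"
proof (induction w arbitrary: u)
  case (Cons d w)
  then show ?case by (cases u) auto
qed simp

lemma splits_length: "(u, v) \<in> set (splits c w) \<Longrightarrow> length w = Suc (length u + length v)"
  by (auto simp: splits_decomp)

lemma splits_snoc:
  "splits c (w @ [d]) = map (\<lambda>(u, v). (u, v @ [d])) (splits c w) @ (if c = d then [(w, [])] else [])"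
  by (induction w) (auto simp: o_def split_def)

lemma sum_list_map_cong:
  "(\<And>x. x \<in> set xs \<Longrightarrow> f x = g x) \<Longrightarrow> sum_list (map f xs) = sum_list (map g xs)"
  by (metis map_cong)

text \<open>The number of noncrossing pairings of the positions of a word in which paired positions carry
the same letter. The recursion looks at the partner of the first letter \<open>c\<close>: it cuts the rest of
the word into an inner part \<open>u\<close> and an outer part \<open>v\<close>, and pairs cannot connect the two. The
values are taken in \<open>real\<close> because they appear as limits.\<close>

function nc_count :: "'a list \<Rightarrow> real" where
  "nc_count [] = 1"
| "nc_count (c # w) = (\<Sum>(u, v)\<leftarrow>splits c w. nc_count u * nc_count v)"
  by pat_completeness auto
termination
  by (relation "Wellfounded.measure length") (auto dest!: splits_length)

lemma nc_count_odd: "odd (length w) \<Longrightarrow> nc_count w = 0"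
proof (induction w rule: nc_count.induct)
  case (2 c w)
  have "nc_count u * nc_count v = 0" if uv: "(u, v) \<in> set (splits c w)" for u v
  proof -
    have "odd (length u) \<or> odd (length v)"
      using splits_length[OF uv] 2(3) by auto
    then show ?thesis using 2(1)[OF uv refl] 2(2)[OF uv refl] by auto
  qed
  then have "(\<Sum>(u, v)\<leftarrow>splits c w. nc_count u * nc_count v) = (\<Sum>_\<leftarrow>splits c w. 0)"
    by (intro sum_list_map_cong) auto
  then show ?case by simp
qed simp

section \<open>Words made of blocks and the recurrences for their pairings\<close>

text \<open>A letter is a boolean: \<open>True\<close> stands for the first matrix and \<open>False\<close> for the second. The sum
\<open>block_sum n f\<close> runs over the \<open>2 ^ n\<close> words that are concatenations of \<open>n\<close> blocks, each of which is
\<open>[True, False]\<close> or \<open>[False, True]\<close>; these are the words in the expansion of the \<open>n\<close>-th power of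
an anticommutator.\<close>

primrec block_sum :: "nat \<Rightarrow> (bool list \<Rightarrow> real) \<Rightarrow> real" where
  "block_sum 0 f = f []"
| "block_sum (Suc n) f =
     block_sum n (\<lambda>w. f (True # False # w)) + block_sum n (\<lambda>w. f (False # True # w))"

lemma block_sum_Suc:
  "block_sum (Suc n) f = block_sum n (\<lambda>w. f (c # (\<not> c) # w)) + block_sum n (\<lambda>w. f ((\<not> c) # c # w))"
  by (cases c) auto

lemma block_sum_cong:
  "(\<And>w. length w = 2 * n \<Longrightarrow> f w = g w) \<Longrightarrow> block_sum n f = block_sum n g"
proof (induction n arbitrary: f g)
  case (Suc n)
  show ?case
    unfolding block_sum.simps by (intro arg_cong2[of _ _ _ _ "(+)"] Suc.IH) (auto intro!: Suc.prems)
qed simp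

lemma block_sum_add: "block_sum n (\<lambda>w. f w + g w) = block_sum n f + block_sum n g"
  by (induction n arbitrary: f g) auto

lemma block_sum_mult_left: "block_sum n (\<lambda>w. c * f w) = c * block_sum n f"
  by (induction n arbitrary: f) (auto simp: distrib_left)

lemma block_sum_mult_right: "block_sum n (\<lambda>w. f w * c) = block_sum n f * c"
  using block_sum_mult_left[of n c f] by (simp add: mult.commute)

lemma block_sum_zero: "block_sum n (\<lambda>w. 0) = 0"
  by (induction n) auto

lemma block_sum_product:
  "block_sum i (\<lambda>u. block_sum j (\<lambda>v. f u * g v)) = block_sum i f * block_sum j g"
  by (simp add: block_sum_mult_left block_sum_mult_right)

lemma block_sum_flip: "block_sum n (\<lambda>w. f (map Not w)) = block_sum n f"
proof (induction n arbitrary: f)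
  case (Suc n)
  show ?case
    using Suc.IH[of "\<lambda>w. f (True # False # w)"] Suc.IH[of "\<lambda>w. f (False # True # w)"] by simp
qed simp

lemma splits_map_Not:
  "splits (\<not> c) (map Not w) = map (\<lambda>(u, v). (map Not u, map Not v)) (splits c w)"
  by (induction w) auto

lemma nc_count_flip: "nc_count (map Not w) = nc_count w"
proof (induction w rule: nc_count.induct)
  case (2 c w)
  show ?case
    unfolding list.map nc_count.simps splits_map_Not
    by (simp add: o_def split_def, rule sum_list_map_cong) (auto simp: 2)
qed simp

text \<open>An occurrence of \<open>c\<close> in a block word lies in a unique block, so it cuts the word either before
a left-over \<open>\<not> c\<close> (block \<open>[c, \<not> c]\<close>) or after one (block \<open>[\<not> c, c]\<close>).\<close>

lemma block_sum_splits:
  "block_sum n (\<lambda>w. \<Sum>(u, v)\<leftarrow>splits c w. g u v) =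
     (\<Sum>i<n. block_sum i (\<lambda>u. block_sum (n - 1 - i) (\<lambda>v. g u ((\<not> c) # v) + g (u @ [\<not> c]) v)))"
proof (induction n arbitrary: g)
  case (Suc n)
  have 1: "(\<Sum>(u, v)\<leftarrow>splits c (c # (\<not> c) # w). g u v) =
      g [] ((\<not> c) # w) + (\<Sum>(u, v)\<leftarrow>splits c w. g (c # (\<not> c) # u) v)" for w
    by (simp add: o_def split_def)
  have 2: "(\<Sum>(u, v)\<leftarrow>splits c ((\<not> c) # c # w). g u v) =
      g [\<not> c] w + (\<Sum>(u, v)\<leftarrow>splits c w. g ((\<not> c) # c # u) v)" for w
    by (simp add: o_def split_def)
  show ?case
    unfolding block_sum_Suc[of _ _ c] 1 2 block_sum_add Suc sum.lessThan_Suc_shift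
    by (simp add: block_sum_add sum.distrib algebra_simps)
qed simp

text \<open>The pairings of all words of \<open>n\<close> blocks, and of those words framed by two equal or by two
different letters.\<close>

definition moment_seq :: "nat \<Rightarrow> real" where
  "moment_seq n = block_sum n nc_count"

definition same_ends_seq :: "nat \<Rightarrow> real" where
  "same_ends_seq n = block_sum n (\<lambda>w. nc_count (True # w @ [True]))"

definition diff_ends_seq :: "nat \<Rightarrow> real" where
  "diff_ends_seq n = block_sum n (\<lambda>w. nc_count (True # w @ [False]))"

text \<open>Exchanging the two letters permutes the block words, so only the equality pattern of the
framing letters matters.\<close>

lemma same_ends_seq: "block_sum n (\<lambda>w. nc_count (c # w @ [c])) = same_ends_seq n"
proof (cases c)
  case False
  have "block_sum n (\<lambda>w. nc_count (c # w @ [c])) =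
      block_sum n (\<lambda>w. nc_count (map Not (c # map Not w @ [c])))"
    using block_sum_flip[of n "\<lambda>w. nc_count (c # w @ [c])"] by (simp only: nc_count_flip)
  then show ?thesis using False by (simp add: same_ends_seq_def o_def)
qed (simp add: same_ends_seq_def)

lemma diff_ends_seq: "block_sum n (\<lambda>w. nc_count (c # w @ [\<not> c])) = diff_ends_seq n"
proof (cases c)
  case False
  have "block_sum n (\<lambda>w. nc_count (c # w @ [\<not> c])) =
      block_sum n (\<lambda>w. nc_count (map Not (c # map Not w @ [\<not> c])))"
    using block_sum_flip[of n "\<lambda>w. nc_count (c # w @ [\<not> c])"] by (simp only: nc_count_flip)
  then show ?thesis using False by (simp add: diff_ends_seq_def o_def)
qed (simp add: diff_ends_seq_def)

lemma moment_seq_0: "moment_seq 0 = 1"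
  by (simp add: moment_seq_def)

text \<open>In this and the next two recurrences, half of the terms of \<open>block_sum_splits\<close> vanish because one of
the two parts has odd length.\<close>

lemma moment_seq_Suc:
  "moment_seq (Suc n) = 2 * (\<Sum>i<n. same_ends_seq i * moment_seq (n - 1 - i))"
proof -
  have "block_sum n (\<lambda>w. nc_count (c # (\<not> c) # w)) =
      (\<Sum>i<n. same_ends_seq i * moment_seq (n - 1 - i))" for c
  proof -
    have "block_sum n (\<lambda>w. nc_count (c # (\<not> c) # w)) =
        block_sum n (\<lambda>w. \<Sum>(u, v)\<leftarrow>splits c w. nc_count ((\<not> c) # u) * nc_count v)"
      by (simp add: o_def split_def)
    also have "\<dots> = (\<Sum>i<n. block_sum i (\<lambda>u. block_sum (n - 1 - i) (\<lambda>v.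
        nc_count ((\<not> c) # u @ [\<not> c]) * nc_count v)))"
      unfolding block_sum_splits
      by (intro sum.cong refl block_sum_cong) (simp del: nc_count.simps add: nc_count_odd)
    finally show ?thesis
      by (simp only: block_sum_product same_ends_seq moment_seq_def)
  qed
  from this[of True] this[of False] show ?thesis
    by (simp only: moment_seq_def block_sum.simps(2) not_True_eq_False not_False_eq_True)
qed

lemma same_ends_seq_rec:
  "same_ends_seq n = moment_seq n + (\<Sum>i<n. moment_seq i * diff_ends_seq (n - 1 - i))"
proof -
  have "same_ends_seq n =
      block_sum n (\<lambda>w. (\<Sum>(u, v)\<leftarrow>splits True w. nc_count u * nc_count (v @ [True])) + nc_count w)"
    unfolding same_ends_seq_def by (simp add: splits_snoc o_def split_def)
  also have "\<dots> = (\<Sum>i<n. block_sum i (\<lambda>u. block_sum (n - 1 - i) (\<lambda>v.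
      nc_count u * nc_count (False # v @ [True])))) + moment_seq n"
    unfolding block_sum_add[of n] block_sum_splits moment_seq_def
    by (intro arg_cong2[of _ _ _ _ "(+)"] sum.cong refl block_sum_cong)
      (simp del: nc_count.simps add: nc_count_odd)
  finally show ?thesis
    using diff_ends_seq[of _ False]
    by (simp del: nc_count.simps add: block_sum_product moment_seq_def)
qed

lemma diff_ends_seq_rec:
  "diff_ends_seq n = (\<Sum>i<n. moment_seq i * same_ends_seq (n - 1 - i))"
proof -
  have "diff_ends_seq n =
      block_sum n (\<lambda>w. (\<Sum>(u, v)\<leftarrow>splits True w. nc_count u * nc_count (v @ [False])))"
    unfolding diff_ends_seq_def by (simp add: splits_snoc o_def split_def)
  also have "\<dots> = (\<Sum>i<n. block_sum i (\<lambda>u. block_sum (n - 1 - i) (\<lambda>v.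
      nc_count u * nc_count (False # v @ [False]))))"
    unfolding block_sum_splits
    by (intro arg_cong2[of _ _ _ _ "(+)"] sum.cong refl block_sum_cong)
      (simp del: nc_count.simps add: nc_count_odd)
  finally show ?thesis
    using same_ends_seq[of _ False]
    by (simp del: nc_count.simps add: block_sum_product moment_seq_def)
qed

section \<open>Generating functions and Lagrange inversion\<close>

unbundle fps_syntax

lemma fps_X_mult_nth': "(fps_X * f) $ n = (if n = 0 then 0 else f $ (n - 1))" for f :: "real fps"
  by simp

lemma fps_X_mult_conv:
  fixes a b :: "nat \<Rightarrow> real"
  shows "(fps_X * (Abs_fps a * Abs_fps b)) $ n = (\<Sum>i<n. a i * b (n - 1 - i))"
proof (cases n)
  case (Suc k)
  then show ?thesis
    unfolding fps_X_mult_nth' fps_mult_nth[of "Abs_fps a"] by (simp add: atLeast0AtMost lessThan_Suc_atMost)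
qed simp

text \<open>The three recurrences say \<open>F = 1 + 2 X\<^sup>2 B F\<close>, \<open>B = F + X F E\<close> and \<open>E = X F B\<close> for the generating
functions \<open>F\<close>, \<open>B\<close>, \<open>E\<close> of \<open>moment_seq\<close>, \<open>same_ends_seq\<close>, \<open>diff_ends_seq\<close>. Eliminating \<open>B\<close> and \<open>E\<close>
leaves a cubic equation for \<open>F\<close>.\<close>

lemma moment_fps_cubic:
  defines "F \<equiv> Abs_fps moment_seq"
  shows "F = 1 + fps_X ^ 2 * (F ^ 2 + F ^ 3)"
proof -
  define B where "B = Abs_fps same_ends_seq"
  define E where "E = Abs_fps diff_ends_seq"
  have F: "F = 1 + fps_const 2 * (fps_X * (fps_X * (B * F)))"
  proof (rule fps_ext)
    fix n
    have "(fps_X * (fps_X * (B * F))) $ n = (if n = 0 then 0 else (\<Sum>i<n-1. same_ends_seq i * moment_seq (n - 1 - 1 - i)))"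
      unfolding fps_X_mult_nth' B_def F_def fps_X_mult_conv[symmetric] by simp
    then show "F $ n = (1 + fps_const 2 * (fps_X * (fps_X * (B * F)))) $ n"
      by (cases n) (auto simp: moment_seq_0 moment_seq_Suc F_def)
  qed
  have B: "B = F + fps_X * (F * E)"
    by (rule fps_ext) (simp only: B_def F_def E_def fps_add_nth fps_X_mult_conv same_ends_seq_rec[symmetric] fps_nth_Abs_fps)
  have E: "E = fps_X * (F * B)"
    by (rule fps_ext) (simp only: B_def F_def E_def fps_X_mult_conv diff_ends_seq_rec[symmetric] fps_nth_Abs_fps)
  have two: "fps_const 2 = (2 :: real fps)" by (simp add: numeral_fps_const)
  have B': "B * (1 - fps_X ^ 2 * F ^ 2) = F"
    using B unfolding E by (simp add: algebra_simps power2_eq_square)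
  have "F * (1 - fps_X ^ 2 * F ^ 2) = (1 - fps_X ^ 2 * F ^ 2) + 2 * fps_X ^ 2 * F * (B * (1 - fps_X ^ 2 * F ^ 2))"
    by (subst F) (simp add: two algebra_simps power2_eq_square)
  then show ?thesis
    unfolding B' by (simp add: algebra_simps power2_eq_square power3_eq_cube)
qed

lemma cubic_unique:
  fixes F G :: "real fps"
  assumes F: "F = 1 + fps_X ^ 2 * (F ^ 2 + F ^ 3)" and G: "G = 1 + fps_X ^ 2 * (G ^ 2 + G ^ 3)"
  shows "F = G"
proof -
  define H where "H = 1 - fps_X ^ 2 * (F + G + F ^ 2 + F * G + G ^ 2)"
  have "F - G = fps_X ^ 2 * (F ^ 2 + F ^ 3) - fps_X ^ 2 * (G ^ 2 + G ^ 3)"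
    using F G by (metis add_diff_cancel_left)
  then have "(F - G) * H = 0"
    unfolding H_def by (simp add: algebra_simps power2_eq_square power3_eq_cube)
  moreover have "H $ 0 = 1" by (simp add: H_def fps_power_zeroth_eq_one)
  then have "H \<noteq> 0" by auto
  ultimately show ?thesis by simp
qed

lemma fps_compose_mult_nth:
  fixes a b h :: "'a::idom fps"
  assumes "b $ 0 = 0"
  shows "((a oo b) * h) $ m = (\<Sum>i\<le>m. a $ i * (b ^ i * h) $ m)"
proof -
  have "((a oo b) * h) $ m = (\<Sum>k\<le>m. \<Sum>i\<le>k. a $ i * (b ^ i) $ k * h $ (m - k))"
    by (simp add: fps_mult_nth fps_compose_nth sum_distrib_right atLeast0AtMost)
  also have "\<dots> = (\<Sum>k\<le>m. \<Sum>i\<le>m. a $ i * (b ^ i) $ k * h $ (m - k))"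
    using startsby_zero_power_prefix[OF assms] by (intro sum.cong refl sum.mono_neutral_left) auto
  also have "\<dots> = (\<Sum>i\<le>m. a $ i * (b ^ i * h) $ m)"
    by (subst sum.swap) (simp add: fps_mult_nth sum_distrib_left mult.assoc atLeast0AtMost)
  finally show ?thesis .
qed

text \<open>Lagrange inversion: the compositional inverse \<open>Z\<close> of \<open>G = X / \<phi>\<close> has
\<open>n [X^n] Z = [X^(n - 1)] \<phi>^n\<close>. Differentiating \<open>Z(G(X)) = X\<close> gives \<open>Z'(G) G' = 1\<close>; multiplied by
\<open>\<phi>^n\<close>, the term of \<open>Z'(G)\<close> of degree \<open>i\<close> contributes \<open>[X^(n - 1)] G^i G' \<phi>^n\<close>. With
\<open>k = n - 1 - i\<close> this is \<open>[X^k] (\<phi>^k - X \<phi>' \<phi>^(k - 1))\<close>, which vanishes for \<open>k > 0\<close> because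
\<open>\<phi>' \<phi>^(k - 1) = (\<phi>^k)' / k\<close>.\<close>

lemma lagrange_inversion_nth:
  fixes \<phi> :: "real fps"
  assumes \<phi>: "\<phi> $ 0 \<noteq> 0"
  shows "real (Suc n) * fps_inv (fps_X * inverse \<phi>) $ Suc n = (\<phi> ^ Suc n) $ n"
proof -
  define \<psi> where "\<psi> = inverse \<phi>"
  define G where "G = fps_X * \<psi>"
  define Z where "Z = fps_inv G"
  have \<phi>\<psi>: "\<phi> * \<psi> = 1" unfolding \<psi>_def using \<phi> by (simp add: inverse_mult_eq_1')
  have G0: "G $ 0 = 0" by (simp add: G_def)
  have "G $ 1 \<noteq> 0" using \<phi> by (simp add: G_def \<psi>_def)
  then have ZG: "Z oo G = fps_X" unfolding Z_def using fps_inv[OF G0] by blast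
  have d: "(fps_deriv Z oo G) * fps_deriv G = 1"
    using fps_compose_deriv[OF G0, of Z] by (simp add: ZG)
  have d\<psi>: "\<phi> * fps_deriv \<psi> = - (fps_deriv \<phi> * \<psi>)"
    using arg_cong[OF \<phi>\<psi>, of fps_deriv] by (simp add: algebra_simps eq_neg_iff_add_eq_0)
  have coeff: "(G ^ i * (fps_deriv G * \<phi> ^ Suc n)) $ n = (if i = n then 1 else 0)" if "i \<le> n" for i
  proof -
    define k where "k = n - i"
    have n: "n = i + k" using that by (simp add: k_def)
    have "\<phi> ^ i * \<psi> ^ i = 1" using \<phi>\<psi> by (metis power_mult_distrib power_one)
    moreover have "G ^ i * (fps_deriv G * \<phi> ^ Suc n) =
        fps_X ^ i * ((\<phi> ^ i * \<psi> ^ i) * \<phi> ^ k * ((\<phi> * \<psi>) + fps_X * (\<phi> * fps_deriv \<psi>)))"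
      unfolding n by (simp add: G_def power_mult_distrib power_add algebra_simps)
    ultimately have eq: "G ^ i * (fps_deriv G * \<phi> ^ Suc n) =
        fps_X ^ i * (\<phi> ^ k - fps_X * (\<phi> ^ k * \<psi> * fps_deriv \<phi>))"
      unfolding \<phi>\<psi> d\<psi> by (simp add: algebra_simps)
    show ?thesis
    proof (cases k)
      case 0
      then show ?thesis using n unfolding eq by (simp add: fps_X_power_mult_nth)
    next
      case (Suc l)
      have "\<phi> ^ k * \<psi> * fps_deriv \<phi> = \<phi> ^ l * fps_deriv \<phi> * (\<phi> * \<psi>)"
        by (simp add: Suc algebra_simps)
      then have eq2: "\<phi> ^ k * \<psi> * fps_deriv \<phi> = \<phi> ^ l * fps_deriv \<phi>" by (simp add: \<phi>\<psi>)
      have "fps_deriv (\<phi> ^ k) = fps_const (real k) * (\<phi> ^ l * fps_deriv \<phi>)"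
        unfolding Suc fps_deriv_power by (simp add: mult_ac del: power_Suc of_nat_Suc)
      then have "real k * (\<phi> ^ k) $ k = real k * (\<phi> ^ l * fps_deriv \<phi>) $ l"
        using Suc fps_deriv_nth[of "\<phi> ^ k" l] by simp
      then have "(\<phi> ^ l * fps_deriv \<phi>) $ l = (\<phi> ^ k) $ k"
        using Suc by simp
      then show ?thesis using n Suc unfolding eq eq2
        by (simp add: fps_X_power_mult_nth del: power_Suc)
    qed
  qed
  have "(\<phi> ^ Suc n) $ n = ((fps_deriv Z oo G) * (fps_deriv G * \<phi> ^ Suc n)) $ n"
    by (simp only: mult.assoc[symmetric] d mult_1)
  also have "\<dots> = (\<Sum>i\<le>n. if i = n then fps_deriv Z $ i else 0)"
    unfolding fps_compose_mult_nth[OF G0]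
    using coeff by (intro sum.cong refl) (simp del: fps_deriv_nth power_Suc)
  also have "\<dots> = fps_deriv Z $ n" by simp
  finally show ?thesis by (simp add: Z_def G_def \<psi>_def)
qed

text \<open>The inverse of \<open>X / \<phi>\<close> solves \<open>Z = X \<phi>(Z)\<close>.\<close>

lemma lagrange_inversion_eq:
  fixes \<phi> :: "real fps"
  assumes \<phi>: "\<phi> $ 0 \<noteq> 0"
  defines "Z \<equiv> fps_inv (fps_X * inverse \<phi>)"
  shows "Z = fps_X * (\<phi> oo Z)"
proof -
  have Z0: "Z $ 0 = 0" by (simp add: Z_def fps_inv_def)
  have "(fps_X * inverse \<phi>) oo Z = fps_X"
    unfolding Z_def using \<phi> by (intro fps_inv_right) auto
  then have 1: "Z * (inverse \<phi> oo Z) = fps_X"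
    by (simp add: fps_compose_mult_distrib[OF Z0] Z0)
  have "(\<phi> oo Z) * (inverse \<phi> oo Z) = (\<phi> * inverse \<phi>) oo Z"
    by (simp add: fps_compose_mult_distrib[OF Z0])
  also have "\<dots> = 1" using \<phi> by (simp add: inverse_mult_eq_1')
  finally have "Z = Z * ((\<phi> oo Z) * (inverse \<phi> oo Z))" by simp
  also have "\<dots> = fps_X * (\<phi> oo Z)" by (simp add: 1[symmetric] mult_ac)
  finally show ?thesis .
qed

lemma fps_const_plus_X_power_nth:
  "((fps_const a + fps_X) ^ m) $ i = of_nat (m choose i) * a ^ (m - i)" for a :: "'a::comm_ring_1"
proof -
  have "((fps_X + fps_const a) ^ m) $ i =
      (\<Sum>k\<le>m. of_nat (m choose k) * (a ^ (m - k) * (if i = k then 1 else 0)))"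
    unfolding binomial_ring fps_sum_nth
    by (intro sum.cong refl)
      (simp add: fps_of_nat[symmetric] mult.assoc fps_const_power mult.commute[of "fps_X ^ _"] del: fps_const_mult)
  also have "\<dots> = of_nat (m choose i) * a ^ (m - i)"
    by (auto simp: if_distrib sum.delta' binomial_eq_0 cong: if_cong)
  finally show ?thesis by (simp add: add.commute)
qed

theorem moment_seq_formula:
  assumes "m \<ge> 1"
  shows "moment_seq (2 * m) =
    1 / real m * (\<Sum>k = 1..m. 2 ^ k * real ((2 * m) choose (k - 1)) * real (m choose k))"
proof -
  \<comment> \<open>with \<open>F = 1 + Z\<close> and \<open>y = X\<^sup>2\<close> the cubic equation reads \<open>Z = y (1 + Z)\<^sup>2 (2 + Z)\<close>\<close>
  define \<phi> :: "real fps" where "\<phi> = (fps_const 1 + fps_X) ^ 2 * (fps_const 2 + fps_X)"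
  define Z where "Z = fps_inv (fps_X * inverse \<phi>)"
  have \<phi>0: "\<phi> $ 0 \<noteq> 0" by (simp add: \<phi>_def power2_eq_square)
  have Z0: "Z $ 0 = 0" by (simp add: Z_def fps_inv_def)
  have two: "fps_const 2 = (2 :: real fps)" by (simp add: numeral_fps_const)
  have "Z = fps_X * (\<phi> oo Z)" unfolding Z_def by (rule lagrange_inversion_eq[OF \<phi>0])
  also have "\<phi> oo Z = (1 + Z) ^ 2 * (2 + Z)"
    by (simp add: \<phi>_def fps_compose_mult_distrib[OF Z0] fps_compose_power[OF Z0, symmetric]
        fps_compose_add_distrib Z0 two[symmetric])
  finally have "Z = fps_X * ((1 + Z) ^ 2 * (2 + Z))" .
  then have Z_eq: "1 + Z = 1 + fps_X * ((1 + Z) ^ 2 + (1 + Z) ^ 3)"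
    by (simp add: algebra_simps power2_eq_square power3_eq_cube)
  define F where "F = (1 + Z) oo fps_X ^ 2"
  have X0: "(fps_X ^ 2 :: real fps) $ 0 = 0" by simp
  have "F = 1 + fps_X ^ 2 * (F ^ 2 + F ^ 3)"
    unfolding F_def
    by (subst Z_eq) (simp only: fps_compose_mult_distrib[OF X0] fps_compose_power[OF X0, symmetric]
        fps_compose_add_distrib fps_X_fps_compose_startby0[OF X0] fps_compose_1)
  then have "Abs_fps moment_seq = F"
    using moment_fps_cubic by (rule cubic_unique[rotated])
  then have "moment_seq (2 * m) = F $ (2 * m)" by (metis fps_nth_Abs_fps)
  also have "\<dots> = (\<Sum>i = 0..2 * m. (1 + Z) $ i * (if 2 * m = 2 * i then 1 else 0))"
    unfolding F_def fps_compose_nth power_mult[symmetric] fps_X_power_nth ..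
  also have "\<dots> = (\<Sum>i = 0..2 * m. if i = m then (1 + Z) $ i else 0)"
    by (intro sum.cong) auto
  also have "\<dots> = Z $ m" using assms by simp
  finally have 1: "moment_seq (2 * m) = Z $ m" .
  obtain n where n: "m = Suc n" using assms by (cases m) auto
  have "real m * Z $ m = (\<phi> ^ m) $ n"
    unfolding n Z_def by (rule lagrange_inversion_nth[OF \<phi>0])
  also have "\<phi> ^ m = (fps_const 1 + fps_X) ^ (2 * m) * (fps_const 2 + fps_X) ^ m"
    by (simp only: \<phi>_def power_mult_distrib power_mult)
  also have "\<dots> $ n = (\<Sum>j\<le>n. real (2 * m choose j) * (real (m choose (n - j)) * 2 ^ (m - (n - j))))"
    unfolding fps_mult_nth fps_const_plus_X_power_nth by (simp add: atLeast0AtMost)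
  also have "\<dots> = (\<Sum>j\<le>n. 2 ^ Suc j * real ((2 * m) choose (Suc j - 1)) * real (m choose Suc j))"
  proof (intro sum.cong refl)
    fix j assume "j \<in> {..n}"
    then have "m - (n - j) = Suc j" "m choose (n - j) = m choose (Suc j)"
      using n binomial_symmetric[of "n - j" m] by (auto simp: Suc_diff_le)
    then show "real (2 * m choose j) * (real (m choose (n - j)) * 2 ^ (m - (n - j))) =
        2 ^ Suc j * real ((2 * m) choose (Suc j - 1)) * real (m choose Suc j)" by simp
  qed
  also have "\<dots> = (\<Sum>k = 1..m. 2 ^ k * real ((2 * m) choose (k - 1)) * real (m choose k))"
    unfolding n One_nat_def sum.atLeast_Suc_atMost_Suc_shift by (simp add: atLeast0AtMost)
  finally show ?thesis using 1 assms by (simp add: field_simps)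
qed

unbundle no fps_syntax

section \<open>Integration by parts for polynomials in the matrix entries\<close>

text \<open>The entry \<open>(c, i, j)\<close> is the one in row \<open>i\<close> and column \<open>j\<close> of the matrix named by the letter
\<open>c\<close>; indices start at \<open>0\<close>.\<close>

type_synonym entry = "bool \<times> nat \<times> nat"

text \<open>The covariance of two entries: the two Kronecker terms add up to variance \<open>2\<close> on the diagonal.\<close>

definition ecov :: "entry \<Rightarrow> entry \<Rightarrow> real" where
  "ecov = (\<lambda>(c, i, j) (d, k, l).
     if c = d then of_bool (i = k \<and> j = l) + of_bool (i = l \<and> j = k) else 0)"

text \<open>A monomial in the entries, as a random variable.\<close>

definition entry_prod :: "(bool \<Rightarrow> nat \<Rightarrow> nat \<Rightarrow> 'w \<Rightarrow> real) \<Rightarrow> entry list \<Rightarrow> 'w \<Rightarrow> real" where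
  "entry_prod X es \<omega> = (\<Prod>(c, i, j)\<leftarrow>es. X c i j \<omega>)"

text \<open>The covariance-weighted derivative of a monomial in the direction of the entry \<open>e\<close>, that is,
the derivation that sends every entry \<open>e'\<close> to \<open>ecov e e'\<close>.\<close>

fun entry_prod_deriv :: "(bool \<Rightarrow> nat \<Rightarrow> nat \<Rightarrow> 'w \<Rightarrow> real) \<Rightarrow> entry \<Rightarrow> entry list \<Rightarrow> 'w \<Rightarrow> real" where
  "entry_prod_deriv X e [] \<omega> = 0"
| "entry_prod_deriv X e ((c, i, j) # es) \<omega> = ecov e (c, i, j) * entry_prod X es \<omega> + X c i j \<omega> * entry_prod_deriv X e es \<omega>"

lemma entry_prod_simps [simp]:
  "entry_prod X [] \<omega> = 1" "entry_prod X ((c, i, j) # es) \<omega> = X c i j \<omega> * entry_prod X es \<omega>"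
  "entry_prod X (es @ fs) \<omega> = entry_prod X es \<omega> * entry_prod X fs \<omega>"
  by (simp_all add: entry_prod_def)

lemma entry_prod_deriv_append:
  "entry_prod_deriv X e (es @ fs) \<omega> = entry_prod_deriv X e es \<omega> * entry_prod X fs \<omega> + entry_prod X es \<omega> * entry_prod_deriv X e fs \<omega>"
  by (induction X e es \<omega> rule: entry_prod_deriv.induct) (auto simp: algebra_simps)

abbreviation entries :: "nat \<Rightarrow> entry set" where
  "entries N \<equiv> UNIV \<times> {..<N} \<times> {..<N}"

text \<open>Random symmetric matrices whose entries satisfy the Gaussian integration by parts formula for
monomials. This is all that the computation of mixed moments uses about the two ensembles.\<close>

locale gaussian_matrices = prob_space M for M :: "'w measure" +
  fixes N :: nat and X :: "bool \<Rightarrow> nat \<Rightarrow> nat \<Rightarrow> 'w \<Rightarrow> real"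
  assumes N_pos: "N > 0"
    and X_sym: "\<And>c i j \<omega>. \<omega> \<in> space M \<Longrightarrow> i < N \<Longrightarrow> j < N \<Longrightarrow> X c i j \<omega> = X c j i \<omega>"
    and integrable_entry_prod: "\<And>es. set es \<subseteq> entries N \<Longrightarrow> integrable M (entry_prod X es)"
    and expectation_entry_prod_Cons: "\<And>e es. e \<in> entries N \<Longrightarrow> set es \<subseteq> entries N \<Longrightarrow>
      expectation (entry_prod X (e # es)) = expectation (entry_prod_deriv X e es)"

lemma sum_sum_list_swap:
  "(\<Sum>k\<in>K. \<Sum>x\<leftarrow>xs. f k x) = (\<Sum>x\<leftarrow>xs. \<Sum>k\<in>K. f k x)"
  for f :: "_ \<Rightarrow> _ \<Rightarrow> 'b::comm_monoid_add"
  by (induction xs) (auto simp: sum.distrib)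

text \<open>All lists of cyclic words that arise from \<open>(c # w) # ws\<close> when the first letter \<open>c\<close> is contracted
with a letter \<open>c\<close> of a word \<open>u @ c # v\<close> of the list \<open>ws\<close>: the two words merge into one, in one of
two relative orientations because the matrices are symmetric.\<close>

fun touching_merges :: "'a \<Rightarrow> 'a list \<Rightarrow> 'a list list \<Rightarrow> 'a list list list" where
  "touching_merges c w [] = []"
| "touching_merges c w (w' # ws) =
     concat (map (\<lambda>(u, v). [(w @ v @ u) # ws, (rev w @ v @ u) # ws]) (splits c w')) @
     map ((#) w') (touching_merges c w ws)"

lemma touching_merges_length:
  "x \<in> set (touching_merges c w ws) \<Longrightarrow>
    length x = length ws \<and> Suc (length (concat x)) = length w + length (concat ws)"
proof (induction c w ws arbitrary: x rule: touching_merges.induct)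
  case (2 c w w' ws)
  from 2(2) show ?case
    using 2(1) by (auto dest!: splits_length)
qed simp

context gaussian_matrices
begin

text \<open>The functions \<open>f\<close> that are polynomial in the matrix entries, together with their derivative \<open>g\<close>
in the direction \<open>e\<close> in the sense of \<open>entry_prod_deriv\<close>.\<close>

inductive has_pderiv :: "entry \<Rightarrow> ('w \<Rightarrow> real) \<Rightarrow> ('w \<Rightarrow> real) \<Rightarrow> bool" for e where
  const: "has_pderiv e (\<lambda>_. a) (\<lambda>_. 0)"
| entry: "has_pderiv e f g \<Longrightarrow> i < N \<Longrightarrow> j < N \<Longrightarrow>
    has_pderiv e (\<lambda>\<omega>. X c i j \<omega> * f \<omega>) (\<lambda>\<omega>. ecov e (c, i, j) * f \<omega> + X c i j \<omega> * g \<omega>)"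
| add: "has_pderiv e f g \<Longrightarrow> has_pderiv e f' g' \<Longrightarrow>
    has_pderiv e (\<lambda>\<omega>. f \<omega> + f' \<omega>) (\<lambda>\<omega>. g \<omega> + g' \<omega>)"

lemma has_pderiv_cong:
  "has_pderiv e f g \<Longrightarrow> (\<And>\<omega>. f \<omega> = f' \<omega>) \<Longrightarrow> (\<And>\<omega>. g \<omega> = g' \<omega>) \<Longrightarrow> has_pderiv e f' g'"
proof -
  assume a: "has_pderiv e f g" "\<And>\<omega>. f \<omega> = f' \<omega>" "\<And>\<omega>. g \<omega> = g' \<omega>"
  then have "f = f'" "g = g'" by auto
  with a(1) show ?thesis by simp
qed

lemma integrable_entry_prod_mult:
  assumes "has_pderiv e f g" and "set es \<subseteq> entries N"
  shows "integrable M (\<lambda>\<omega>. entry_prod X es \<omega> * f \<omega>)"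
  using assms
proof (induction arbitrary: es rule: has_pderiv.induct)
  case (const a)
  then show ?case using integrable_entry_prod by simp
next
  case (entry f g i j c)
  have "integrable M (\<lambda>\<omega>. entry_prod X (es @ [(c, i, j)]) \<omega> * f \<omega>)"
    using entry by (intro entry.IH) auto
  then show ?case by (simp add: mult.assoc)
next
  case (add f g f' g')
  then show ?case by (simp add: distrib_left)
qed

lemma integrable_entry_prod_mult_deriv:
  assumes "has_pderiv e f g" and "set es \<subseteq> entries N"
  shows "integrable M (\<lambda>\<omega>. entry_prod X es \<omega> * g \<omega>)"
  using assms
proof (induction arbitrary: es rule: has_pderiv.induct)
  case (entry f g i j c)
  have "integrable M (\<lambda>\<omega>. entry_prod X (es @ [(c, i, j)]) \<omega> * g \<omega>)"
    using entry by (intro entry.IH) auto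
  moreover have "integrable M (\<lambda>\<omega>. ecov e (c, i, j) * (entry_prod X es \<omega> * f \<omega>))"
    using integrable_entry_prod_mult[OF entry.hyps(1) entry.prems] by simp
  ultimately have "integrable M (\<lambda>\<omega>. ecov e (c, i, j) * (entry_prod X es \<omega> * f \<omega>) +
      entry_prod X (es @ [(c, i, j)]) \<omega> * g \<omega>)" by (rule Bochner_Integration.integrable_add[rotated])
  then show ?case by (simp add: algebra_simps)
next
  case (add f g f' g')
  then show ?case by (simp add: distrib_left)
qed simp

lemma integrable_poly: "has_pderiv e f g \<Longrightarrow> integrable M f"
  using integrable_entry_prod_mult[of e f g "[]"] by simp

lemma integrable_poly_deriv: "has_pderiv e f g \<Longrightarrow> integrable M g"
  using integrable_entry_prod_mult_deriv[of e f g "[]"] by simp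

lemma integrable_entry_prod_deriv_mult:
  assumes "has_pderiv e f g" "set es \<subseteq> entries N" "set fs \<subseteq> entries N"
  shows "integrable M (\<lambda>\<omega>. entry_prod X es \<omega> * (entry_prod_deriv X e' fs \<omega> * f \<omega>))"
  using assms(2,3)
proof (induction fs arbitrary: es)
  case (Cons x fs)
  obtain c i j where x: "x = (c, i, j)" by (cases x)
  have "integrable M (\<lambda>\<omega>. ecov e' x * (entry_prod X (es @ fs) \<omega> * f \<omega>) +
      entry_prod X (es @ [x]) \<omega> * (entry_prod_deriv X e' fs \<omega> * f \<omega>))"
    using Cons.prems by (intro Bochner_Integration.integrable_add integrable_mult_right
        integrable_entry_prod_mult[OF assms(1)] Cons.IH) auto
  then show ?case by (simp add: x algebra_simps)
qed simp

text \<open>The factor \<open>entry_prod X es\<close> makes the induction over the polynomial \<open>f\<close> work: it collects the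
entries that have been split off from \<open>f\<close>.\<close>

lemma integration_by_parts_entry_prod:
  assumes "has_pderiv e f g" "e \<in> entries N" "set es \<subseteq> entries N"
  shows "expectation (\<lambda>\<omega>. entry_prod X (e # es) \<omega> * f \<omega>) =
    expectation (\<lambda>\<omega>. entry_prod_deriv X e es \<omega> * f \<omega> + entry_prod X es \<omega> * g \<omega>)"
  using assms
proof (induction arbitrary: es rule: has_pderiv.induct)
  case (const a)
  then show ?case using expectation_entry_prod_Cons[of e es] by simp
next
  case (entry f g i j c)
  obtain a b d where e: "e = (a, b, d)" by (cases e)
  have "expectation (\<lambda>\<omega>. entry_prod X (e # es @ [(c, i, j)]) \<omega> * f \<omega>) =
    expectation (\<lambda>\<omega>. entry_prod_deriv X e (es @ [(c, i, j)]) \<omega> * f \<omega> + entry_prod X (es @ [(c, i, j)]) \<omega> * g \<omega>)"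
    using entry by (intro entry.IH) auto
  then show ?case by (simp add: e entry_prod_deriv_append algebra_simps)
next
  case (add f g f' g')
  have es: "set (e # es) \<subseteq> entries N" using add.prems by simp
  have "expectation (\<lambda>\<omega>. entry_prod X (e # es) \<omega> * f \<omega> + entry_prod X (e # es) \<omega> * f' \<omega>) =
      expectation (\<lambda>\<omega>. entry_prod X (e # es) \<omega> * f \<omega>) + expectation (\<lambda>\<omega>. entry_prod X (e # es) \<omega> * f' \<omega>)"
    by (intro Bochner_Integration.integral_add integrable_entry_prod_mult[OF add.hyps(1) es]
        integrable_entry_prod_mult[OF add.hyps(2) es])
  also have "\<dots> = expectation (\<lambda>\<omega>. entry_prod_deriv X e es \<omega> * f \<omega> + entry_prod X es \<omega> * g \<omega>) +
      expectation (\<lambda>\<omega>. entry_prod_deriv X e es \<omega> * f' \<omega> + entry_prod X es \<omega> * g' \<omega>)"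
    using add by simp
  also have "\<dots> = expectation (\<lambda>\<omega>. (entry_prod_deriv X e es \<omega> * f \<omega> + entry_prod X es \<omega> * g \<omega>) +
      (entry_prod_deriv X e es \<omega> * f' \<omega> + entry_prod X es \<omega> * g' \<omega>))"
    using integrable_entry_prod_deriv_mult[OF add.hyps(1), of "[]" es e] integrable_entry_prod_deriv_mult[OF add.hyps(2), of "[]" es e]
      integrable_entry_prod_mult_deriv[OF add.hyps(1)] integrable_entry_prod_mult_deriv[OF add.hyps(2)] add.prems
    by (intro Bochner_Integration.integral_add[symmetric] Bochner_Integration.integrable_add) auto
  finally show ?case by (simp add: algebra_simps)
qed

lemma integration_by_parts:
  assumes "has_pderiv (c, i, j) f g" "i < N" "j < N"
  shows "expectation (\<lambda>\<omega>. X c i j \<omega> * f \<omega>) = expectation g"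
  using integration_by_parts_entry_prod[OF assms(1), of "[]"] assms by simp

lemma has_pderiv_scale: "has_pderiv e f g \<Longrightarrow> has_pderiv e (\<lambda>\<omega>. a * f \<omega>) (\<lambda>\<omega>. a * g \<omega>)"
proof (induction rule: has_pderiv.induct)
  case (const b)
  then show ?case using has_pderiv.const[of e "a * b"] by simp
next
  case (entry f g i j c)
  show ?case
    by (rule has_pderiv_cong[OF has_pderiv.entry[OF entry.IH entry.hyps(2,3)]]) (auto simp: algebra_simps)
next
  case (add f g f' g')
  show ?case
    by (rule has_pderiv_cong[OF has_pderiv.add[OF add.IH]]) (auto simp: algebra_simps)
qed

lemma has_pderiv_mult:
  assumes "has_pderiv e f g" "has_pderiv e f' g'"
  shows "has_pderiv e (\<lambda>\<omega>. f \<omega> * f' \<omega>) (\<lambda>\<omega>. g \<omega> * f' \<omega> + f \<omega> * g' \<omega>)"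
  using assms(1)
proof (induction rule: has_pderiv.induct)
  case (const a)
  then show ?case using has_pderiv_scale[OF assms(2), of a] by simp
next
  case (entry f g i j c)
  show ?case
    by (rule has_pderiv_cong[OF has_pderiv.entry[OF entry.IH entry.hyps(2,3)]]) (auto simp: algebra_simps)
next
  case (add f1 g1 f2 g2)
  show ?case
    by (rule has_pderiv_cong[OF has_pderiv.add[OF add.IH]]) (auto simp: algebra_simps)
qed

lemma has_pderiv_sum:
  "finite K \<Longrightarrow> (\<And>k. k \<in> K \<Longrightarrow> has_pderiv e (f k) (g k)) \<Longrightarrow>
    has_pderiv e (\<lambda>\<omega>. \<Sum>k\<in>K. f k \<omega>) (\<lambda>\<omega>. \<Sum>k\<in>K. g k \<omega>)"
  by (induction K rule: finite_induct) (auto intro: has_pderiv.const has_pderiv.add)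

section \<open>Traces of words and the loop equation\<close>

text \<open>The entries of the matrix product spelled by a word, the empty word giving the identity.\<close>

fun word_entry :: "bool list \<Rightarrow> nat \<Rightarrow> nat \<Rightarrow> 'w \<Rightarrow> real" where
  "word_entry [] i j \<omega> = of_bool (i = j)"
| "word_entry (c # w) i j \<omega> = (\<Sum>k<N. X c i k \<omega> * word_entry w k j \<omega>)"

text \<open>The trace of the matrix product spelled by a word.\<close>

definition word_trace :: "bool list \<Rightarrow> 'w \<Rightarrow> real" where
  "word_trace w \<omega> = (\<Sum>i<N. word_entry w i i \<omega>)"

text \<open>Products of traces have to be treated together with single traces, because contracting two
letters of one trace breaks it into two.\<close>

definition trace_prod :: "bool list list \<Rightarrow> 'w \<Rightarrow> real" where
  "trace_prod ws \<omega> = (\<Prod>w\<leftarrow>ws. word_trace w \<omega>)"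

lemma trace_prod_simps [simp]:
  "trace_prod [] = (\<lambda>\<omega>. 1)" "trace_prod (w # ws) = (\<lambda>\<omega>. word_trace w \<omega> * trace_prod ws \<omega>)"
  by (simp_all add: trace_prod_def fun_eq_iff)

lemma word_entry_append:
  "i < N \<Longrightarrow> word_entry (u @ v) i j \<omega> = (\<Sum>k<N. word_entry u i k \<omega> * word_entry v k j \<omega>)"
proof (induction u arbitrary: i)
  case (Cons c u)
  have "word_entry ((c # u) @ v) i j \<omega> =
      (\<Sum>l<N. \<Sum>k<N. X c i l \<omega> * (word_entry u l k \<omega> * word_entry v k j \<omega>))"
    using Cons by (simp add: sum_distrib_left)
  also have "\<dots> = (\<Sum>k<N. word_entry (c # u) i k \<omega> * word_entry v k j \<omega>)"
    by (subst sum.swap) (simp add: sum_distrib_right mult.assoc)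
  finally show ?case .
qed simp

lemma word_entry_rev:
  "\<omega> \<in> space M \<Longrightarrow> i < N \<Longrightarrow> j < N \<Longrightarrow> word_entry (rev w) i j \<omega> = word_entry w j i \<omega>"
proof (induction w arbitrary: i j)
  case (Cons c w)
  then show ?case
    by (simp add: word_entry_append) (intro sum.cong refl, simp add: X_sym[of \<omega> j])
qed auto

lemma word_trace_append:
  "word_trace (u @ v) \<omega> = (\<Sum>a<N. \<Sum>b<N. word_entry u a b \<omega> * word_entry v b a \<omega>)"
  by (simp add: word_trace_def word_entry_append)

lemma word_trace_rev_append:
  "\<omega> \<in> space M \<Longrightarrow>
    word_trace (rev u @ v) \<omega> = (\<Sum>a<N. \<Sum>b<N. word_entry u b a \<omega> * word_entry v b a \<omega>)"
  by (simp add: word_trace_append word_entry_rev)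

text \<open>The derivative of the entry \<open>(i, j)\<close> of the product spelled by \<open>w\<close>: each occurrence of the letter
\<open>c\<close> is removed, and by symmetry of the matrices the cut is closed with both orders of \<open>a\<close>, \<open>b\<close>.\<close>

definition word_entry_deriv :: "entry \<Rightarrow> bool list \<Rightarrow> nat \<Rightarrow> nat \<Rightarrow> 'w \<Rightarrow> real" where
  "word_entry_deriv = (\<lambda>(c, a, b) w i j \<omega>. \<Sum>(u, v)\<leftarrow>splits c w.
     word_entry u i a \<omega> * word_entry v b j \<omega> + word_entry u i b \<omega> * word_entry v a j \<omega>)"

lemma has_pderiv_word_entry:
  assumes "a < N" "b < N" "i < N"
  shows "has_pderiv (c, a, b) (word_entry w i j) (word_entry_deriv (c, a, b) w i j)"
  using assms(3)
proof (induction w arbitrary: i)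
  case Nil
  then show ?case using has_pderiv.const by (simp add: word_entry_deriv_def)
next
  case (Cons d w)
  let ?g = "\<lambda>\<omega>. \<Sum>k<N. ecov (c, a, b) (d, i, k) * word_entry w k j \<omega> +
      X d i k \<omega> * word_entry_deriv (c, a, b) w k j \<omega>"
  have "?g \<omega> = word_entry_deriv (c, a, b) (d # w) i j \<omega>" for \<omega>
  proof -
    have 1: "(\<Sum>k<N. ecov (c, a, b) (d, i, k) * word_entry w k j \<omega>) =
        (if c = d then of_bool (i = a) * word_entry w b j \<omega> + of_bool (i = b) * word_entry w a j \<omega> else 0)"
    proof -
      have "(\<Sum>k<N. (of_bool (a = i \<and> b = k) + of_bool (a = k \<and> b = i)) * word_entry w k j \<omega>) =
          (\<Sum>k<N. if k = b then of_bool (i = a) * word_entry w k j \<omega> else 0) +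
          (\<Sum>k<N. if k = a then of_bool (i = b) * word_entry w k j \<omega> else 0)"
        unfolding sum.distrib[symmetric] by (intro sum.cong) auto
      then show ?thesis using assms by (simp add: ecov_def)
    qed
    have 2: "(\<Sum>k<N. X d i k \<omega> * word_entry_deriv (c, a, b) w k j \<omega>) =
        (\<Sum>(u, v)\<leftarrow>splits c w. word_entry (d # u) i a \<omega> * word_entry v b j \<omega> +
          word_entry (d # u) i b \<omega> * word_entry v a j \<omega>)"
      unfolding word_entry_deriv_def prod.case sum_list_const_mult[symmetric] sum_sum_list_swap
      by (intro sum_list_map_cong)
        (auto simp: sum_distrib_left sum.distrib algebra_simps)
    show ?thesis
      unfolding sum.distrib 1 2 by (simp add: word_entry_deriv_def o_def split_def)
  qed
  moreover have "has_pderiv (c, a, b) (\<lambda>\<omega>. \<Sum>k<N. X d i k \<omega> * word_entry w k j \<omega>) ?g"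
    using Cons by (intro has_pderiv_sum has_pderiv.entry) auto
  ultimately show ?case
    by (elim has_pderiv_cong) auto
qed

text \<open>By cyclicity, removing a letter from a trace leaves the entries of a single word.\<close>

definition word_trace_deriv :: "entry \<Rightarrow> bool list \<Rightarrow> 'w \<Rightarrow> real" where
  "word_trace_deriv = (\<lambda>(c, a, b) w \<omega>. \<Sum>(u, v)\<leftarrow>splits c w.
     word_entry (v @ u) b a \<omega> + word_entry (v @ u) a b \<omega>)"

lemma has_pderiv_word_trace:
  assumes "a < N" "b < N"
  shows "has_pderiv (c, a, b) (word_trace w) (word_trace_deriv (c, a, b) w)"
proof -
  have "has_pderiv (c, a, b) (\<lambda>\<omega>. \<Sum>i<N. word_entry w i i \<omega>)
      (\<lambda>\<omega>. \<Sum>i<N. word_entry_deriv (c, a, b) w i i \<omega>)"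
    using assms by (intro has_pderiv_sum has_pderiv_word_entry) auto
  moreover have "(\<Sum>i<N. word_entry_deriv (c, a, b) w i i \<omega>) = word_trace_deriv (c, a, b) w \<omega>" for \<omega>
    unfolding word_entry_deriv_def word_trace_deriv_def prod.case sum_sum_list_swap
    using assms
    by (intro sum_list_map_cong)
      (auto simp: word_entry_append sum.distrib[symmetric] algebra_simps intro!: sum.cong)
  ultimately show ?thesis
    by (elim has_pderiv_cong) (auto simp: word_trace_def)
qed

text \<open>The derivative of a product of traces, by the Leibniz rule.\<close>

fun trace_prod_deriv :: "entry \<Rightarrow> bool list list \<Rightarrow> 'w \<Rightarrow> real" where
  "trace_prod_deriv e [] \<omega> = 0"
| "trace_prod_deriv e (w # ws) \<omega> =
     word_trace_deriv e w \<omega> * trace_prod ws \<omega> + word_trace w \<omega> * trace_prod_deriv e ws \<omega>"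

lemma has_pderiv_trace_prod:
  assumes "a < N" "b < N"
  shows "has_pderiv (c, a, b) (trace_prod ws) (trace_prod_deriv (c, a, b) ws)"
proof (induction ws)
  case Nil
  show ?case by (rule has_pderiv_cong[OF has_pderiv.const]) auto
next
  case (Cons w ws)
  show ?case
    by (rule has_pderiv_cong[OF has_pderiv_mult[OF has_pderiv_word_trace[OF assms] Cons]]) auto
qed

lemma integrable_trace_prod: "integrable M (trace_prod ws)"
  using integrable_poly[OF has_pderiv_trace_prod[OF N_pos N_pos]] .

lemma sum_list_concat_pairs:
  "(\<Sum>x\<leftarrow>concat (map (\<lambda>p. [g p, h p]) xs). f x) = (\<Sum>p\<leftarrow>xs. f (g p) + f (h p))"
  for f :: "_ \<Rightarrow> 'b::comm_monoid_add"
  by (induction xs) (auto simp: add_ac)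

lemma trace_prod_deriv_contract:
  assumes "\<omega> \<in> space M"
  shows "(\<Sum>a<N. \<Sum>b<N. word_entry w b a \<omega> * trace_prod_deriv (c, a, b) ws \<omega>) =
    (\<Sum>x\<leftarrow>touching_merges c w ws. trace_prod x \<omega>)"
proof (induction ws)
  case (Cons w' ws)
  have "(\<Sum>a<N. \<Sum>b<N. word_entry w b a \<omega> * word_trace_deriv (c, a, b) w' \<omega>) =
      (\<Sum>(u, v)\<leftarrow>splits c w'. word_trace (w @ v @ u) \<omega> + word_trace (rev w @ v @ u) \<omega>)"
    unfolding word_trace_deriv_def prod.case sum_list_const_mult[symmetric] sum_sum_list_swap
    by (intro sum_list_map_cong)
      (auto simp: word_trace_append[of w] word_trace_rev_append[OF assms] sum.distrib[symmetric]
        distrib_left sum.swap[of "\<lambda>a b. word_entry w b a \<omega> * _ a b"] intro!: sum.cong)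
  moreover have "(\<Sum>a<N. \<Sum>b<N. word_entry w b a \<omega> * trace_prod_deriv (c, a, b) (w' # ws) \<omega>) =
      (\<Sum>a<N. \<Sum>b<N. word_entry w b a \<omega> * word_trace_deriv (c, a, b) w' \<omega>) * trace_prod ws \<omega> +
      word_trace w' \<omega> * (\<Sum>a<N. \<Sum>b<N. word_entry w b a \<omega> * trace_prod_deriv (c, a, b) ws \<omega>)"
    by (simp add: sum.distrib sum_distrib_left sum_distrib_right algebra_simps)
  ultimately have "(\<Sum>a<N. \<Sum>b<N. word_entry w b a \<omega> * trace_prod_deriv (c, a, b) (w' # ws) \<omega>) =
      (\<Sum>(u, v)\<leftarrow>splits c w'. word_trace (w @ v @ u) \<omega> + word_trace (rev w @ v @ u) \<omega>) * trace_prod ws \<omega> +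
      word_trace w' \<omega> * (\<Sum>x\<leftarrow>touching_merges c w ws. trace_prod x \<omega>)"
    unfolding Cons by simp
  also have "\<dots> = (\<Sum>x\<leftarrow>touching_merges c w (w' # ws). trace_prod x \<omega>)"
    by (simp add: sum_list_concat_pairs sum_list_mult_const[symmetric] sum_list_const_mult[symmetric]
        o_def split_def distrib_right)
  finally show ?case .
qed simp

lemma word_entry_deriv_contract:
  assumes "\<omega> \<in> space M"
  shows "(\<Sum>a<N. \<Sum>b<N. word_entry_deriv (c, a, b) w b a \<omega>) =
    (\<Sum>(u, v)\<leftarrow>splits c w. word_trace u \<omega> * word_trace v \<omega> + word_trace (rev u @ v) \<omega>)"
  unfolding word_entry_deriv_def prod.case sum_sum_list_swap
proof (intro sum_list_map_cong, clarify)
  fix u v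
  have "(\<Sum>a<N. \<Sum>b<N. word_entry u b b \<omega> * word_entry v a a \<omega>) = word_trace u \<omega> * word_trace v \<omega>"
    unfolding word_trace_def sum_product by (rule sum.swap)
  then show "(\<Sum>a<N. \<Sum>b<N. word_entry u b a \<omega> * word_entry v b a \<omega> +
      word_entry u b b \<omega> * word_entry v a a \<omega>) = word_trace u \<omega> * word_trace v \<omega> + word_trace (rev u @ v) \<omega>"
    by (simp add: sum.distrib word_trace_rev_append[OF assms])
qed

lemma expectation_sum_list:
  "(\<And>x. x \<in> set xs \<Longrightarrow> integrable M (f x)) \<Longrightarrow>
    integrable M (\<lambda>\<omega>. \<Sum>x\<leftarrow>xs. f x \<omega>) \<and>
    expectation (\<lambda>\<omega>. \<Sum>x\<leftarrow>xs. f x \<omega>) = (\<Sum>x\<leftarrow>xs. expectation (f x))" for f :: "'b \<Rightarrow> 'w \<Rightarrow> real"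
  by (induction xs) auto

lemma expectation_double_sum:
  fixes h :: "nat \<Rightarrow> nat \<Rightarrow> 'w \<Rightarrow> real"
  assumes "\<And>a b. a < N \<Longrightarrow> b < N \<Longrightarrow> integrable M (h a b)"
  shows "expectation (\<lambda>\<omega>. \<Sum>a<N. \<Sum>b<N. h a b \<omega>) = (\<Sum>a<N. \<Sum>b<N. expectation (h a b))"
proof -
  have "expectation (\<lambda>\<omega>. \<Sum>a<N. \<Sum>b<N. h a b \<omega>) = (\<Sum>a<N. expectation (\<lambda>\<omega>. \<Sum>b<N. h a b \<omega>))"
    using assms by (intro Bochner_Integration.integral_sum Bochner_Integration.integrable_sum) auto
  also have "\<dots> = (\<Sum>a<N. \<Sum>b<N. expectation (h a b))"
    using assms by (intro sum.cong refl Bochner_Integration.integral_sum) auto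
  finally show ?thesis .
qed

text \<open>The loop (Schwinger--Dyson) equation. Contracting the first letter \<open>c\<close> with another letter of the
same trace either splits the trace in two or, with the reverse orientation, reverses one part;
contracting it with a letter of another trace merges the two traces.\<close>

lemma loop_equation:
  "expectation (trace_prod ((c # w) # ws)) =
     (\<Sum>(u, v)\<leftarrow>splits c w. expectation (trace_prod (u # v # ws)) + expectation (trace_prod ((rev u @ v) # ws))) +
     (\<Sum>x\<leftarrow>touching_merges c w ws. expectation (trace_prod x))"
proof -
  let ?f = "\<lambda>a b \<omega>. word_entry w b a \<omega> * trace_prod ws \<omega>"
  let ?g = "\<lambda>a b \<omega>. word_entry_deriv (c, a, b) w b a \<omega> * trace_prod ws \<omega> +
      word_entry w b a \<omega> * trace_prod_deriv (c, a, b) ws \<omega>"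
  have D: "has_pderiv (c, a, b) (?f a b) (?g a b)" if "a < N" "b < N" for a b
    using that by (intro has_pderiv_mult has_pderiv_word_entry has_pderiv_trace_prod)
  have int: "integrable M (\<lambda>\<omega>. X c a b \<omega> * ?f a b \<omega>)" if "a < N" "b < N" for a b
    using integrable_poly[OF has_pderiv.entry[OF D[OF that] that]] .
  have "expectation (trace_prod ((c # w) # ws)) =
      expectation (\<lambda>\<omega>. \<Sum>a<N. \<Sum>b<N. X c a b \<omega> * ?f a b \<omega>)"
    by (simp add: word_trace_def sum_distrib_right mult.assoc)
  also have "\<dots> = (\<Sum>a<N. \<Sum>b<N. expectation (\<lambda>\<omega>. X c a b \<omega> * ?f a b \<omega>))"
    using int by (rule expectation_double_sum)
  also have "\<dots> = (\<Sum>a<N. \<Sum>b<N. expectation (?g a b))"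
    by (intro sum.cong refl integration_by_parts D) auto
  also have "\<dots> = expectation (\<lambda>\<omega>. \<Sum>a<N. \<Sum>b<N. ?g a b \<omega>)"
    by (rule expectation_double_sum[symmetric]) (rule integrable_poly_deriv[OF D])
  also have "\<dots> = expectation (\<lambda>\<omega>.
      (\<Sum>(u, v)\<leftarrow>splits c w. trace_prod (u # v # ws) \<omega> + trace_prod ((rev u @ v) # ws) \<omega>) +
      (\<Sum>x\<leftarrow>touching_merges c w ws. trace_prod x \<omega>))"
  proof (rule Bochner_Integration.integral_cong[OF refl])
    fix \<omega> assume \<omega>: "\<omega> \<in> space M"
    have "(\<Sum>a<N. \<Sum>b<N. ?g a b \<omega>) =
        (\<Sum>a<N. \<Sum>b<N. word_entry_deriv (c, a, b) w b a \<omega>) * trace_prod ws \<omega> +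
        (\<Sum>a<N. \<Sum>b<N. word_entry w b a \<omega> * trace_prod_deriv (c, a, b) ws \<omega>)"
      by (simp add: sum.distrib sum_distrib_right)
    also have "(\<Sum>a<N. \<Sum>b<N. word_entry_deriv (c, a, b) w b a \<omega>) * trace_prod ws \<omega> =
        (\<Sum>(u, v)\<leftarrow>splits c w. trace_prod (u # v # ws) \<omega> + trace_prod ((rev u @ v) # ws) \<omega>)"
      unfolding word_entry_deriv_contract[OF \<omega>] sum_list_mult_const[symmetric]
      by (intro sum_list_map_cong) (auto simp: algebra_simps)
    finally show "(\<Sum>a<N. \<Sum>b<N. ?g a b \<omega>) =
        (\<Sum>(u, v)\<leftarrow>splits c w. trace_prod (u # v # ws) \<omega> + trace_prod ((rev u @ v) # ws) \<omega>) +
        (\<Sum>x\<leftarrow>touching_merges c w ws. trace_prod x \<omega>)"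
      unfolding trace_prod_deriv_contract[OF \<omega>] .
  qed
  also have "\<dots> =
     (\<Sum>(u, v)\<leftarrow>splits c w. expectation (trace_prod (u # v # ws)) + expectation (trace_prod ((rev u @ v) # ws))) +
     (\<Sum>x\<leftarrow>touching_merges c w ws. expectation (trace_prod x))"
    unfolding split_def
    by (simp add: expectation_sum_list integrable_trace_prod del: trace_prod_simps)
  finally show ?thesis .
qed

lemma expectation_trace_prod_Nil: "expectation (trace_prod []) = 1"
  by (simp add: prob_space)

lemma expectation_trace_prod_Nil_Cons:
  "expectation (trace_prod ([] # ws)) = real N * expectation (trace_prod ws)"
  by (simp add: word_trace_def)

end

section \<open>The large-dimension limit\<close>

lemma tendsto_sum_list:
  "(\<And>x. x \<in> set xs \<Longrightarrow> (f x \<longlongrightarrow> l x) F) \<Longrightarrow> ((\<lambda>n. \<Sum>x\<leftarrow>xs. f x n) \<longlongrightarrow> (\<Sum>x\<leftarrow>xs. l x)) F"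
  for l :: "_ \<Rightarrow> real"
  by (induction xs) (auto intro!: tendsto_add)

lemma sum_list_divide: "(\<Sum>x\<leftarrow>xs. f x) / c = (\<Sum>x\<leftarrow>xs. f x / c)" for c :: real
  by (induction xs) (auto simp: add_divide_distrib)

text \<open>The exponent of \<open>sqrt N\<close> by which the expectation of a product of traces is normalised: one
factor \<open>sqrt N\<close> for each letter and one factor \<open>N\<close> for each trace.\<close>

definition scaling_exponent :: "'a list list \<Rightarrow> nat" where
  "scaling_exponent ws = length (concat ws) + 2 * length ws"

text \<open>In the loop equation, the terms in which a trace splits have the same scaling exponent as the
left-hand side, the reversed terms lose a factor \<open>N\<close>, and the merged ones a factor \<open>N\<^sup>2\<close>. Hence only
the first survive in the limit, where they give the recursion of \<open>nc_count\<close> in every trace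
separately.\<close>

lemma loop_equation_limit:
  fixes T :: "nat \<Rightarrow> 'a list list \<Rightarrow> real"
  assumes Nil: "\<And>N. N > 0 \<Longrightarrow> T N [] = 1"
    and Nil_Cons: "\<And>N ws. N > 0 \<Longrightarrow> T N ([] # ws) = real N * T N ws"
    and loop: "\<And>N c w ws. N > 0 \<Longrightarrow> T N ((c # w) # ws) =
      (\<Sum>(u, v)\<leftarrow>splits c w. T N (u # v # ws) + T N ((rev u @ v) # ws)) +
      (\<Sum>x\<leftarrow>touching_merges c w ws. T N x)"
  shows "(\<lambda>N. T N ws / sqrt (real N) ^ scaling_exponent ws) \<longlonglongrightarrow> (\<Prod>w\<leftarrow>ws. nc_count w)"
proof (induction "length (concat ws) + length ws" arbitrary: ws rule: less_induct)
  case less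
  let ?R = "\<lambda>ws N. T N ws / sqrt (real N) ^ scaling_exponent ws"
  let ?L = "\<lambda>ws. \<Prod>w\<leftarrow>ws. nc_count w"
  have ev: "eventually (\<lambda>N. N > 0) sequentially" by (rule eventually_gt_at_top)
  consider "ws = []" | ws' where "ws = [] # ws'" | c w ws' where "ws = (c # w) # ws'"
    by (metis neq_Nil_conv)
  then show ?case
  proof cases
    case 1
    have "eventually (\<lambda>N. 1 = ?R [] N) sequentially"
      using ev by eventually_elim (simp add: Nil scaling_exponent_def)
    from tendsto_cong[THEN iffD1, OF this tendsto_const] show ?thesis by (simp add: 1)
  next
    case (2 ws')
    have "eventually (\<lambda>N. ?R ws' N = ?R ws N) sequentially"
      using ev by eventually_elim (simp add: 2 Nil_Cons scaling_exponent_def power_add field_simps)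
    moreover have "?R ws' \<longlonglongrightarrow> ?L ws'" using less[of ws'] by (simp add: 2)
    ultimately show ?thesis using tendsto_cong[of "?R ws'"] by (fastforce simp: 2)
  next
    case (3 c w ws')
    have lim0: "(\<lambda>N. 1 / real N) \<longlonglongrightarrow> 0" by (rule lim_1_over_n)
    have A: "(\<lambda>N. ?R (u # v # ws') N + ?R ((rev u @ v) # ws') N * (1 / real N)) \<longlonglongrightarrow>
        nc_count u * nc_count v * ?L ws'" if "(u, v) \<in> set (splits c w)" for u v
    proof -
      note len = splits_length[OF that]
      have "?R (u # v # ws') \<longlonglongrightarrow> ?L (u # v # ws')"
        using len by (intro less) (simp add: 3)
      moreover have "?R ((rev u @ v) # ws') \<longlonglongrightarrow> ?L ((rev u @ v) # ws')"
        using len by (intro less) (simp add: 3)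
      from tendsto_mult[OF this lim0]
      have "(\<lambda>N. ?R ((rev u @ v) # ws') N * (1 / real N)) \<longlonglongrightarrow> 0" by simp
      ultimately show ?thesis using tendsto_add by (fastforce simp: mult.assoc)
    qed
    have B: "(\<lambda>N. ?R x N * (1 / real N * (1 / real N))) \<longlonglongrightarrow> 0" if "x \<in> set (touching_merges c w ws')" for x
    proof -
      have "?R x \<longlonglongrightarrow> ?L x"
        using touching_merges_length[OF that] by (intro less) (simp add: 3)
      from tendsto_mult[OF this tendsto_mult[OF lim0 lim0]] show ?thesis by simp
    qed
    have "(\<lambda>N. (\<Sum>(u, v)\<leftarrow>splits c w. ?R (u # v # ws') N + ?R ((rev u @ v) # ws') N * (1 / real N)) +
        (\<Sum>x\<leftarrow>touching_merges c w ws'. ?R x N * (1 / real N * (1 / real N)))) \<longlonglongrightarrow>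
        (\<Sum>(u, v)\<leftarrow>splits c w. nc_count u * nc_count v * ?L ws') + (\<Sum>x\<leftarrow>touching_merges c w ws'. 0)"
      unfolding split_def
      by (intro tendsto_add tendsto_sum_list B) (use A in auto)
    also have "(\<Sum>(u, v)\<leftarrow>splits c w. nc_count u * nc_count v * ?L ws') + (\<Sum>x\<leftarrow>touching_merges c w ws'. 0) = ?L ws"
      by (simp add: 3 sum_list_mult_const[symmetric] split_def)
    finally have lim: "(\<lambda>N. (\<Sum>(u, v)\<leftarrow>splits c w. ?R (u # v # ws') N + ?R ((rev u @ v) # ws') N * (1 / real N)) +
        (\<Sum>x\<leftarrow>touching_merges c w ws'. ?R x N * (1 / real N * (1 / real N)))) \<longlonglongrightarrow> ?L ws" .
    have "eventually (\<lambda>N. (\<Sum>(u, v)\<leftarrow>splits c w. ?R (u # v # ws') N + ?R ((rev u @ v) # ws') N * (1 / real N)) +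
        (\<Sum>x\<leftarrow>touching_merges c w ws'. ?R x N * (1 / real N * (1 / real N))) = ?R ws N) sequentially"
      using ev
    proof eventually_elim
      case (elim N)
      define s where "s = sqrt (real N)"
      have s: "s > 0" "real N = s ^ 2" using elim by (auto simp: s_def)
      define e where "e = scaling_exponent ws"
      have 1: "T N (u # v # ws') / s ^ scaling_exponent (u # v # ws') +
          T N ((rev u @ v) # ws') / s ^ scaling_exponent ((rev u @ v) # ws') * (1 / real N) =
          (T N (u # v # ws') + T N ((rev u @ v) # ws')) / s ^ e"
        if "(u, v) \<in> set (splits c w)" for u v
      proof -
        define k where "k = scaling_exponent ((rev u @ v) # ws')"
        have "scaling_exponent (u # v # ws') = k + 2" "e = k + 2"
          using splits_length[OF that] by (auto simp: k_def e_def 3 scaling_exponent_def)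
        then show ?thesis unfolding k_def[symmetric] using s
          by (simp add: power_add power2_eq_square add_divide_distrib mult_ac)
      qed
      have 2: "T N x / s ^ scaling_exponent x * (1 / real N * (1 / real N)) = T N x / s ^ e"
        if "x \<in> set (touching_merges c w ws')" for x
      proof -
        have "e = scaling_exponent x + 4"
          using touching_merges_length[OF that] by (auto simp: e_def 3 scaling_exponent_def)
        then show ?thesis using s by (simp add: power_add power2_eq_square power4_eq_xxxx)
      qed
      have "T N ws / s ^ e =
          (\<Sum>(u, v)\<leftarrow>splits c w. (T N (u # v # ws') + T N ((rev u @ v) # ws')) / s ^ e) +
          (\<Sum>x\<leftarrow>touching_merges c w ws'. T N x / s ^ e)"
        unfolding 3 loop[OF elim] add_divide_distrib[of _ _ "s ^ e"] sum_list_divide split_def ..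
      also have "\<dots> = (\<Sum>(u, v)\<leftarrow>splits c w. T N (u # v # ws') / s ^ scaling_exponent (u # v # ws') +
          T N ((rev u @ v) # ws') / s ^ scaling_exponent ((rev u @ v) # ws') * (1 / real N)) +
        (\<Sum>x\<leftarrow>touching_merges c w ws'. T N x / s ^ scaling_exponent x * (1 / real N * (1 / real N)))"
      proof (intro arg_cong2[of _ _ _ _ "(+)"] sum_list_map_cong, clarify)
        show "(T N (u # v # ws') + T N ((rev u @ v) # ws')) / s ^ e =
            T N (u # v # ws') / s ^ scaling_exponent (u # v # ws') +
            T N ((rev u @ v) # ws') / s ^ scaling_exponent ((rev u @ v) # ws') * (1 / real N)"
          if "(u, v) \<in> set (splits c w)" for u v
          using 1[OF that] by (rule sym)
      qed (rule 2[symmetric])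
      finally show ?case unfolding s_def e_def by (rule sym)
    qed
    with lim show ?thesis using tendsto_cong by fast
  qed
qed

section \<open>Independent Gaussian Orthogonal Ensembles\<close>

text \<open>The \<open>k\<close>-th moment of the centred normal distribution with standard deviation \<open>\<sigma>\<close>.\<close>

definition normal_moment :: "real \<Rightarrow> nat \<Rightarrow> real" where
  "normal_moment \<sigma> k = (\<integral>x. normal_density 0 \<sigma> x * x ^ k \<partial>lborel)"

text \<open>For \<open>k = 0\<close> the truncated \<open>k - 1\<close> is harmless, because the factor \<open>k\<close> is zero.\<close>

lemma normal_moment_rec:
  assumes "\<sigma> > 0"
  shows "normal_moment \<sigma> (Suc k) = real k * \<sigma>\<^sup>2 * normal_moment \<sigma> (k - 1)"
proof (cases "even k")
  case True
  then obtain l where l: "k = 2 * l" by (elim evenE)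
  have 1: "normal_moment \<sigma> (Suc k) = 0"
    using integral_normal_moment_odd[OF assms, of 0 l] by (simp add: l normal_moment_def)
  show ?thesis
  proof (cases l)
    case 0
    then show ?thesis using 1 l by simp
  next
    case (Suc m)
    then have "normal_moment \<sigma> (k - 1) = 0"
      using integral_normal_moment_odd[OF assms, of 0 m] by (simp add: l normal_moment_def)
    then show ?thesis using 1 by simp
  qed
next
  case False
  then obtain l where l: "k = 2 * l + 1" by (elim oddE)
  have "normal_moment \<sigma> (Suc k) = fact (2 * Suc l) / ((2 / \<sigma>\<^sup>2) ^ Suc l * fact (Suc l))"
    using integral_normal_moment_even[OF assms, of 0 "Suc l"] by (simp add: l normal_moment_def)
  moreover have "normal_moment \<sigma> (k - 1) = fact (2 * l) / ((2 / \<sigma>\<^sup>2) ^ l * fact l)"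
    using integral_normal_moment_even[OF assms, of 0 l] by (simp add: l normal_moment_def)
  moreover have "fact (2 * Suc l) = 2 * real (Suc l) * real (2 * l + 1) * fact (2 * l)"
    by (simp add: algebra_simps)
  ultimately show ?thesis using assms
    by (simp add: l del: of_nat_Suc of_nat_add of_nat_mult)
qed

lemma (in prob_space) distributed_normal_power:
  assumes X: "distributed M lborel X (normal_density 0 \<sigma>)" and "\<sigma> > 0"
  shows "integrable M (\<lambda>\<omega>. X \<omega> ^ k)" "expectation (\<lambda>\<omega>. X \<omega> ^ k) = normal_moment \<sigma> k"
proof -
  have "integrable lborel (\<lambda>x. normal_density 0 \<sigma> x * x ^ k)"
    using integrable_normal_moment[OF assms(2), of 0 k] by simp
  then show "integrable M (\<lambda>\<omega>. X \<omega> ^ k)"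
    using distributed_integrable[OF X, of "\<lambda>x. x ^ k"] by (simp add: normal_density_nonneg)
  show "expectation (\<lambda>\<omega>. X \<omega> ^ k) = normal_moment \<sigma> k"
    using distributed_integral[OF X, of "\<lambda>x. x ^ k"]
    by (simp add: normal_density_nonneg normal_moment_def)
qed

text \<open>The independent entries of a symmetric matrix are those on and above the diagonal; \<open>slot\<close> maps
the position of an entry to the position of the independent entry that it equals.\<close>

definition slots :: "nat \<Rightarrow> (nat \<times> nat) set" where
  "slots N = {(i, j). i \<le> j \<and> j < N}"

definition slot :: "nat \<times> nat \<Rightarrow> nat \<times> nat" where
  "slot = (\<lambda>(i, j). (min i j, max i j))"

text \<open>The standard deviation of the independent entry at a given position.\<close>

definition slot_sd :: "nat \<times> nat \<Rightarrow> real" where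
  "slot_sd = (\<lambda>(i, j). if i = j then sqrt 2 else 1)"

text \<open>How often the independent entry \<open>v\<close> of the matrix \<open>c\<close> occurs in a monomial.\<close>

definition slot_count :: "bool \<Rightarrow> nat \<times> nat \<Rightarrow> entry list \<Rightarrow> nat" where
  "slot_count c v es = count_list (map (map_prod id slot) es) (c, v)"

lemma finite_slots: "finite (slots N)"
  by (rule finite_subset[of _ "{..<N} \<times> {..<N}"]) (auto simp: slots_def)

lemma slot_count_simps [simp]:
  "slot_count c v [] = 0"
  "slot_count c v ((d, p) # es) = (if d = c \<and> slot p = v then Suc (slot_count c v es) else slot_count c v es)"
  "slot_count c v (es @ fs) = slot_count c v es + slot_count c v fs"
  by (auto simp: slot_count_def)

lemma slot_sd_pos: "slot_sd v > 0"
  by (auto simp: slot_sd_def split: prod.splits)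

lemma slot_in_slots: "i < N \<Longrightarrow> j < N \<Longrightarrow> slot (i, j) \<in> slots N"
  by (auto simp: slot_def slots_def)

lemma ecov_eq_slot:
  "ecov (c, p) (d, q) = (if d = c \<and> slot q = slot p then (slot_sd (slot p))\<^sup>2 else 0)"
  by (cases p; cases q) (auto simp: ecov_def slot_def slot_sd_def min_def max_def)

text \<open>If the expectation of a monomial factors into moments of independent centred normal variables,
then the recursion of these moments yields the integration by parts formula for monomials.\<close>

lemma gaussian_matricesI:
  fixes X :: "bool \<Rightarrow> nat \<Rightarrow> nat \<Rightarrow> 'w \<Rightarrow> real"
  assumes M: "prob_space M" and N: "N > 0"
    and X_sym: "\<And>c i j \<omega>. \<omega> \<in> space M \<Longrightarrow> i < N \<Longrightarrow> j < N \<Longrightarrow> X c i j \<omega> = X c j i \<omega>"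
    and int: "\<And>es. set es \<subseteq> entries N \<Longrightarrow> integrable M (entry_prod X es)"
    and exp: "\<And>es. set es \<subseteq> entries N \<Longrightarrow> prob_space.expectation M (entry_prod X es) =
      (\<Prod>(c, v)\<in>UNIV \<times> slots N. normal_moment (slot_sd v) (slot_count c v es))"
  shows "gaussian_matrices M N X"
proof -
  interpret prob_space M by fact
  have "expectation (entry_prod X (e # es)) = expectation (entry_prod_deriv X e es)"
    if e: "e \<in> entries N" and es: "set es \<subseteq> entries N" for e es
  proof -
    obtain c i j where e_eq: "e = (c, i, j)" by (cases e)
    define v where "v = slot (i, j)"
    have v: "v \<in> slots N" using e slot_in_slots by (auto simp: e_eq v_def)
    define R where "R qs = (\<Prod>(d, u)\<in>UNIV \<times> slots N - {(c, v)}. normal_moment (slot_sd u) (slot_count d u qs))" for qs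
    have exp': "expectation (entry_prod X qs) = normal_moment (slot_sd v) (slot_count c v qs) * R qs"
      if "set qs \<subseteq> entries N" for qs
      unfolding exp[OF that] R_def using v
      by (subst prod.remove[of _ "(c, v)"]) (auto simp: finite_slots)
    have R_Cons: "R (pre @ (c, p) # es) = R (pre @ es)" if "slot p = v" for pre p es
      unfolding R_def
    proof (intro prod.cong refl)
      fix x assume "x \<in> UNIV \<times> slots N - {(c, v)}"
      moreover obtain d u where x: "x = (d, u)" by (cases x)
      ultimately have ne: "\<not> (c = d \<and> slot p = u)" using that by blast
      show "(case x of (d, u) \<Rightarrow> normal_moment (slot_sd u) (slot_count d u (pre @ (c, p) # es))) =
          (case x of (d, u) \<Rightarrow> normal_moment (slot_sd u) (slot_count d u (pre @ es)))"
        using ne by (simp only: x prod.case slot_count_simps if_False)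
    qed
    \<comment> \<open>the terms of the derivative in which \<open>e\<close> is contracted with a factor in \<open>fs\<close>; they all have the same expectation\<close>
    have *: "integrable M (\<lambda>\<omega>. entry_prod X pre \<omega> * entry_prod_deriv X e fs \<omega>) \<and>
        expectation (\<lambda>\<omega>. entry_prod X pre \<omega> * entry_prod_deriv X e fs \<omega>) =
        real (slot_count c v fs) * (slot_sd v)\<^sup>2 * normal_moment (slot_sd v) (slot_count c v (pre @ fs) - 1) * R (pre @ fs)"
      if "set pre \<subseteq> entries N" "set fs \<subseteq> entries N" for pre fs
      using that
    proof (induction fs arbitrary: pre)
      case (Cons x fs)
      obtain d p where x: "x = (d, p)" by (cases x)
      have fs: "set (pre @ fs) \<subseteq> entries N" and x_in: "x \<in> entries N" using Cons.prems by auto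
      note IH = Cons.IH[of "pre @ [x]"]
      have pre: "set (pre @ [x]) \<subseteq> entries N" using Cons.prems by auto
      have split: "entry_prod X pre \<omega> * entry_prod_deriv X e (x # fs) \<omega> =
          ecov e x * entry_prod X (pre @ fs) \<omega> + entry_prod X (pre @ [x]) \<omega> * entry_prod_deriv X e fs \<omega>" for \<omega>
        by (cases x) (auto simp: algebra_simps)
      have "integrable M (\<lambda>\<omega>. entry_prod X pre \<omega> * entry_prod_deriv X e (x # fs) \<omega>)"
        unfolding split using int[OF fs] IH[OF pre] Cons.prems by (simp del: entry_prod_simps)
      moreover have "expectation (\<lambda>\<omega>. entry_prod X pre \<omega> * entry_prod_deriv X e (x # fs) \<omega>) =
          ecov e x * expectation (entry_prod X (pre @ fs)) +
          expectation (\<lambda>\<omega>. entry_prod X (pre @ [x]) \<omega> * entry_prod_deriv X e fs \<omega>)"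
        unfolding split using int[OF fs] IH[OF pre] Cons.prems
        by (subst Bochner_Integration.integral_add) (auto simp del: entry_prod_simps)
      then have E: "expectation (\<lambda>\<omega>. entry_prod X pre \<omega> * entry_prod_deriv X e (x # fs) \<omega>) =
          ecov e x * (normal_moment (slot_sd v) (slot_count c v (pre @ fs)) * R (pre @ fs)) +
          real (slot_count c v fs) * (slot_sd v)\<^sup>2 * normal_moment (slot_sd v) (slot_count c v (pre @ x # fs) - 1) * R (pre @ x # fs)"
        unfolding exp'[OF fs] using IH[OF pre] Cons.prems by (simp del: entry_prod_simps slot_count_simps)
      have "\<dots> = real (slot_count c v (x # fs)) * (slot_sd v)\<^sup>2 *
          normal_moment (slot_sd v) (slot_count c v (pre @ x # fs) - 1) * R (pre @ x # fs)"
      proof (cases "d = c \<and> slot p = v")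
        case True
        then show ?thesis
          using R_Cons[of p pre fs] by (simp add: x e_eq ecov_eq_slot v_def[symmetric] algebra_simps)
      next
        case False
        then show ?thesis by (auto simp: x e_eq ecov_eq_slot v_def[symmetric])
      qed
      with E calculation show ?case by simp
    qed simp
    have "expectation (entry_prod X (e # es)) =
        normal_moment (slot_sd v) (Suc (slot_count c v es)) * R es"
      using exp'[of "e # es"] R_Cons[of "(i, j)" "[]" es] e es by (simp add: e_eq v_def)
    also have "\<dots> = expectation (entry_prod_deriv X e es)"
      using *[of "[]" es] es by (simp add: normal_moment_rec[OF slot_sd_pos])
    finally show ?thesis .
  qed
  then show ?thesis
    by (intro gaussian_matrices.intro gaussian_matrices_axioms.intro M N X_sym int)
qed

lemma entry_measurable_mat_borel:
  assumes "i < N" "j < N"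
  shows "(\<lambda>X. X $$ (i, j)) \<in> measurable (mat_borel N) borel"
proof -
  let ?f = "\<lambda>X. \<lambda>ij\<in>{..<N} \<times> {..<N}. (X :: real mat) $$ ij"
  have "?f \<in> measurable (mat_borel N) (PiM ({..<N} \<times> {..<N}) (\<lambda>_. borel))"
    unfolding mat_borel_def
    by (rule measurable_vimage_algebra1) (auto simp: space_PiM)
  then have "(\<lambda>X. ?f X (i, j)) \<in> measurable (mat_borel N) borel"
    by (rule measurable_compose[OF _ measurable_component_singleton]) (use assms in auto)
  then show ?thesis using assms by simp
qed

text \<open>The monomial with exponents \<open>n\<close> in the independent entries of a symmetric matrix.\<close>

definition slot_monomial :: "nat \<Rightarrow> (nat \<times> nat \<Rightarrow> nat) \<Rightarrow> real mat \<Rightarrow> real" where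
  "slot_monomial N n X = (\<Prod>v\<in>slots N. (X $$ v) ^ n v)"

lemma slot_monomial_measurable: "slot_monomial N n \<in> measurable (mat_borel N) borel"
  unfolding slot_monomial_def
  by (intro borel_measurable_prod borel_measurable_power)
    (auto simp: slots_def intro!: entry_measurable_mat_borel)

lemma GOE_slot_monomial:
  assumes "GOE P N A"
  shows "integrable P (\<lambda>\<omega>. slot_monomial N n (A \<omega>))"
    "prob_space.expectation P (\<lambda>\<omega>. slot_monomial N n (A \<omega>)) =
      (\<Prod>v\<in>slots N. normal_moment (slot_sd v) (n v))"
proof -
  interpret prob_space P using assms by (simp add: GOE_def)
  have dist: "distributed P lborel (\<lambda>\<omega>. A \<omega> $$ v) (normal_density 0 (slot_sd v))" if "v \<in> slots N" for v
    using that assms by (auto simp: slots_def slot_sd_def GOE_def le_less)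
  note int = distributed_normal_power[OF dist slot_sd_pos]
  have "indep_vars (\<lambda>_. borel) (\<lambda>(i, j) \<omega>. A \<omega> $$ (i, j)) (slots N)"
    using assms by (simp add: GOE_def slots_def)
  then have ind: "indep_vars (\<lambda>_. borel) (\<lambda>v \<omega>. (A \<omega> $$ v) ^ n v) (slots N)"
    using indep_vars_compose2[of "\<lambda>_. borel" "\<lambda>(i, j) \<omega>. A \<omega> $$ (i, j)" "slots N"
        "\<lambda>v x. x ^ n v" "\<lambda>_. borel"]
    by (simp add: split_def)
  show "integrable P (\<lambda>\<omega>. slot_monomial N n (A \<omega>))"
    unfolding slot_monomial_def using int by (intro indep_vars_integrable[OF finite_slots ind]) auto
  have "expectation (\<lambda>\<omega>. slot_monomial N n (A \<omega>)) = (\<Prod>v\<in>slots N. expectation (\<lambda>\<omega>. (A \<omega> $$ v) ^ n v))"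
    unfolding slot_monomial_def using int by (intro indep_vars_lebesgue_integral[OF finite_slots ind]) auto
  then show "expectation (\<lambda>\<omega>. slot_monomial N n (A \<omega>)) = (\<Prod>v\<in>slots N. normal_moment (slot_sd v) (n v))"
    using int by simp
qed

lemma GOE_symmetric:
  assumes "GOE P N A" "\<omega> \<in> space P" "i < N" "j < N"
  shows "A \<omega> $$ (i, j) = A \<omega> $$ (j, i)"
proof -
  have "transpose_mat (A \<omega>) = A \<omega>" "A \<omega> \<in> carrier_mat N N" using assms by (auto simp: GOE_def)
  then show ?thesis using assms(3,4) by (metis carrier_matD index_transpose_mat(1))
qed

text \<open>A monomial in the entries of two symmetric matrices is a product of one monomial in the
independent entries of each.\<close>

lemma entry_prod_eq_slot_monomials:
  assumes sym: "\<And>c i j. i < N \<Longrightarrow> j < N \<Longrightarrow> Y c $$ (i, j) = Y c $$ (j, i)"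
    and "set es \<subseteq> entries N"
  shows "(\<Prod>(c, i, j)\<leftarrow>es. Y c $$ (i, j)) =
    slot_monomial N (\<lambda>v. slot_count True v es) (Y True) * slot_monomial N (\<lambda>v. slot_count False v es) (Y False)"
  using assms(2)
proof (induction es)
  case (Cons e es)
  obtain c i j where e: "e = (c, i, j)" by (cases e)
  have ij: "i < N" "j < N" using Cons.prems by (auto simp: e)
  have Y: "Y c $$ slot (i, j) = Y c $$ (i, j)"
    using sym[OF ij] by (auto simp: slot_def min_def max_def)
  have 1: "slot_monomial N (\<lambda>v. slot_count c v (e # es)) (Y c) =
      Y c $$ (i, j) * slot_monomial N (\<lambda>v. slot_count c v es) (Y c)"
  proof -
    have "(\<Prod>v\<in>slots N - {slot (i, j)}. (Y c $$ v) ^ slot_count c v (e # es)) =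
        (\<Prod>v\<in>slots N - {slot (i, j)}. (Y c $$ v) ^ slot_count c v es)"
      by (intro prod.cong) (auto simp: e)
    then show ?thesis
      unfolding slot_monomial_def prod.remove[OF finite_slots slot_in_slots[OF ij]]
      by (simp add: e Y)
  qed
  have 2: "slot_monomial N (\<lambda>v. slot_count d v (e # es)) (Y d) = slot_monomial N (\<lambda>v. slot_count d v es) (Y d)"
    if "d \<noteq> c" for d using that by (simp add: slot_monomial_def e)
  show ?case using 1 2[of "\<not> c"] Cons by (cases c) (simp_all add: e)
qed (simp add: slot_monomial_def)

theorem gaussian_matrices_GOE:
  fixes A B :: "'w \<Rightarrow> real mat"
  assumes A: "GOE P N A" and B: "GOE P N B"
    and indep: "prob_space.indep_var P (mat_borel N) A (mat_borel N) B" and N: "N > 0"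
  shows "gaussian_matrices P N (\<lambda>c i j \<omega>. (if c then A \<omega> else B \<omega>) $$ (i, j))"
proof -
  interpret prob_space P using A by (simp add: GOE_def)
  let ?X = "\<lambda>c i j \<omega>. (if c then A \<omega> else B \<omega>) $$ (i, j)"
  let ?m = "\<lambda>c es. slot_monomial N (\<lambda>v. slot_count c v es)"
  have sym: "?X c i j \<omega> = ?X c j i \<omega>" if "\<omega> \<in> space P" "i < N" "j < N" for c i j \<omega>
    using that GOE_symmetric[OF A] GOE_symmetric[OF B] by auto
  have eq: "entry_prod ?X es \<omega> = ?m True es (A \<omega>) * ?m False es (B \<omega>)"
    if "set es \<subseteq> entries N" "\<omega> \<in> space P" for es \<omega>
    using entry_prod_eq_slot_monomials[of N "\<lambda>c. if c then A \<omega> else B \<omega>" es] sym that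
    by (simp add: entry_prod_def)
  have ind: "indep_var borel (\<lambda>\<omega>. ?m True es (A \<omega>)) borel (\<lambda>\<omega>. ?m False es (B \<omega>))" for es
    using indep_var_compose[OF indep slot_monomial_measurable slot_monomial_measurable] by (simp add: o_def)
  note int = GOE_slot_monomial(1)[OF A] GOE_slot_monomial(1)[OF B]
  show ?thesis
  proof (rule gaussian_matricesI[OF prob_space_axioms N])
    fix es assume es: "set es \<subseteq> entries N"
    show "integrable P (entry_prod ?X es)"
      using indep_var_integrable[OF ind int] eq[OF es]
      by (subst Bochner_Integration.integrable_cong[OF refl, of _ _ "\<lambda>\<omega>. ?m True es (A \<omega>) * ?m False es (B \<omega>)"]) auto
    have "expectation (entry_prod ?X es) = expectation (\<lambda>\<omega>. ?m True es (A \<omega>) * ?m False es (B \<omega>))"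
      by (intro Bochner_Integration.integral_cong refl eq[OF es])
    also have "\<dots> = (\<Prod>c\<in>UNIV. \<Prod>v\<in>slots N. normal_moment (slot_sd v) (slot_count c v es))"
      unfolding indep_var_lebesgue_integral[OF ind int] GOE_slot_monomial(2)[OF A] GOE_slot_monomial(2)[OF B]
      by (simp add: UNIV_bool mult.commute)
    finally show "expectation (entry_prod ?X es) =
        (\<Prod>(c, v)\<in>UNIV \<times> slots N. normal_moment (slot_sd v) (slot_count c v es))"
      by (simp add: prod.cartesian_product)
  qed (use sym in auto)
qed

section \<open>Moments of the anticommutator\<close>

lemma pow_mat_Suc_left:
  "A \<in> carrier_mat n n \<Longrightarrow> A ^\<^sub>m Suc k = A * A ^\<^sub>m k"
proof (induction k)
  case (Suc k)
  then show ?case by (metis assoc_mult_mat pow_carrier_mat pow_mat.simps(2))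
qed simp

lemma block_sum_sum:
  "(\<Sum>k\<in>K. a k * block_sum n (f k)) = block_sum n (\<lambda>w. \<Sum>k\<in>K. a k * f k w)"
  by (induction K rule: infinite_finite_induct)
    (auto simp: block_sum_zero block_sum_add block_sum_mult_left)

lemma tendsto_block_sum:
  "(\<And>w. length w = 2 * n \<Longrightarrow> ((\<lambda>N. f N w) \<longlongrightarrow> g w) F) \<Longrightarrow>
    ((\<lambda>N. block_sum n (f N)) \<longlongrightarrow> block_sum n g) F"
  by (induction n arbitrary: f g) (auto intro!: tendsto_add)

context gaussian_matrices
begin

lemma anticommutator_power_entry:
  assumes "Y True \<in> carrier_mat N N" "Y False \<in> carrier_mat N N"
    and X: "\<And>c i j. i < N \<Longrightarrow> j < N \<Longrightarrow> X c i j \<omega> = Y c $$ (i, j)"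
    and "i < N" "j < N"
  shows "(anticommutator (Y True) (Y False) ^\<^sub>m n) $$ (i, j) = block_sum n (\<lambda>w. word_entry w i j \<omega>)"
  using \<open>i < N\<close>
proof (induction n arbitrary: i)
  case 0
  then show ?case using assms by (simp add: anticommutator_def)
next
  case (Suc n)
  let ?C = "anticommutator (Y True) (Y False)"
  have C: "?C \<in> carrier_mat N N" using assms by (simp add: anticommutator_def)
  have C_entry: "?C $$ (i, k) = (\<Sum>l<N. X True i l \<omega> * X False l k \<omega>) + (\<Sum>l<N. X False i l \<omega> * X True l k \<omega>)"
    if "k < N" for k
    using assms(1,2) Suc.prems that X
    by (simp add: anticommutator_def scalar_prod_def atLeast0LessThan)
  have word: "(\<Sum>k<N. (\<Sum>l<N. X c i l \<omega> * X d l k \<omega>) * word_entry w k j \<omega>) = word_entry (c # d # w) i j \<omega>"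
    for c d w
    by (simp add: sum_distrib_left sum_distrib_right mult.assoc) (rule sum.swap)
  have "(?C ^\<^sub>m Suc n) $$ (i, j) = (\<Sum>k<N. ?C $$ (i, k) * (?C ^\<^sub>m n) $$ (k, j))"
    unfolding pow_mat_Suc_left[OF C]
    using C Suc.prems \<open>j < N\<close> pow_carrier_mat[OF C, of n]
    by (simp add: scalar_prod_def atLeast0LessThan)
  also have "\<dots> = (\<Sum>k<N. ?C $$ (i, k) * block_sum n (\<lambda>w. word_entry w k j \<omega>))"
    using Suc.IH by simp
  also have "\<dots> = block_sum n (\<lambda>w. \<Sum>k<N. ?C $$ (i, k) * word_entry w k j \<omega>)"
    by (rule block_sum_sum)
  also have "\<dots> = block_sum n (\<lambda>w. word_entry (True # False # w) i j \<omega> + word_entry (False # True # w) i j \<omega>)"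
    unfolding word[symmetric] sum.distrib[symmetric] by (simp add: C_entry distrib_right)
  finally show ?case by (simp only: block_sum_add block_sum.simps)
qed

lemma trace_anticommutator_power:
  assumes "Y True \<in> carrier_mat N N" "Y False \<in> carrier_mat N N"
    and "\<And>c i j. i < N \<Longrightarrow> j < N \<Longrightarrow> X c i j \<omega> = Y c $$ (i, j)"
  shows "mat_trace (anticommutator (Y True) (Y False) ^\<^sub>m n) = block_sum n (\<lambda>w. word_trace w \<omega>)"
proof -
  have C: "anticommutator (Y True) (Y False) \<in> carrier_mat N N" using assms by (simp add: anticommutator_def)
  have "mat_trace (anticommutator (Y True) (Y False) ^\<^sub>m n) =
      (\<Sum>i<N. 1 * block_sum n (\<lambda>w. word_entry w i i \<omega>))"
    using anticommutator_power_entry[OF assms] C by (simp add: mat_trace_def)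
  then show ?thesis unfolding block_sum_sum by (simp add: word_trace_def)
qed

lemma expectation_block_sum:
  assumes "\<And>w. integrable M (f w)"
  shows "expectation (\<lambda>\<omega>. block_sum n (\<lambda>w. f w \<omega>)) = block_sum n (\<lambda>w. expectation (f w))"
proof -
  have "integrable M (\<lambda>\<omega>. block_sum n (\<lambda>w. f w \<omega>)) \<and>
      expectation (\<lambda>\<omega>. block_sum n (\<lambda>w. f w \<omega>)) = block_sum n (\<lambda>w. expectation (f w))"
    using assms by (induction n arbitrary: f) auto
  then show ?thesis ..
qed

end

theorem theorem1p9:
  fixes P :: "nat \<Rightarrow> 'w measure" and A B :: "nat \<Rightarrow> 'w \<Rightarrow> real mat" and m :: nat
  assumes "\<And>N. GOE (P N) N (A N)"
    and "\<And>N. GOE (P N) N (B N)"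
    and "\<And>N. prob_space.indep_var (P N) (mat_borel N) (A N) (mat_borel N) (B N)"
    and "m \<ge> 1"
  shows "(\<lambda>N. 1 / real N ^ (2 * m + 1) *
             prob_space.expectation (P N)
               (\<lambda>\<omega>. mat_trace (anticommutator (A N \<omega>) (B N \<omega>) ^\<^sub>m (2 * m))))
           \<longlonglongrightarrow> 1 / real m * (\<Sum>k = 1..m. 2 ^ k * real ((2 * m) choose (k - 1)) * real (m choose k))"
proof -
  define X where "X N c i j \<omega> = (if c then A N \<omega> else B N \<omega>) $$ (i, j)" for N c i j \<omega>
  define T where "T N ws = integral\<^sup>L (P N) (gaussian_matrices.trace_prod N (X N) ws)" for N ws
  \<comment> \<open>the locale requires \<open>N > 0\<close>, which is no restriction in the limit\<close>
  have gm: "gaussian_matrices (P N) N (X N)" if "N > 0" for N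
    unfolding X_def using assms(1-3) that by (rule gaussian_matrices_GOE)
  have lim: "(\<lambda>N. T N ws / sqrt (real N) ^ scaling_exponent ws) \<longlonglongrightarrow> (\<Prod>w\<leftarrow>ws. nc_count w)" for ws
    unfolding T_def
    using gaussian_matrices.expectation_trace_prod_Nil[OF gm]
      gaussian_matrices.expectation_trace_prod_Nil_Cons[OF gm] gaussian_matrices.loop_equation[OF gm]
    by (intro loop_equation_limit) auto
  have "(\<lambda>N. T N [w] / real N ^ (2 * m + 1)) \<longlonglongrightarrow> nc_count w" if "length w = 2 * (2 * m)" for w
  proof -
    have "sqrt (real N) ^ scaling_exponent [w] = real N ^ (2 * m + 1)" for N
    proof -
      have "scaling_exponent [w] = 2 * (2 * m + 1)" by (simp add: scaling_exponent_def that)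
      then show ?thesis by (simp only: power_mult real_sqrt_pow2 of_nat_0_le_iff)
    qed
    then show ?thesis using lim[of "[w]"] by simp
  qed
  then have "(\<lambda>N. block_sum (2 * m) (\<lambda>w. T N [w] / real N ^ (2 * m + 1))) \<longlonglongrightarrow> moment_seq (2 * m)"
    unfolding moment_seq_def by (rule tendsto_block_sum)
  moreover have "eventually (\<lambda>N. block_sum (2 * m) (\<lambda>w. T N [w] / real N ^ (2 * m + 1)) =
      1 / real N ^ (2 * m + 1) * prob_space.expectation (P N)
        (\<lambda>\<omega>. mat_trace (anticommutator (A N \<omega>) (B N \<omega>) ^\<^sub>m (2 * m)))) sequentially"
    using eventually_gt_at_top[of 0]
  proof eventually_elim
    case (elim N)
    interpret gaussian_matrices "P N" N "X N" by (rule gm[OF elim])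
    have tr: "mat_trace (anticommutator (A N \<omega>) (B N \<omega>) ^\<^sub>m (2 * m)) =
        block_sum (2 * m) (\<lambda>w. trace_prod [w] \<omega>)" if "\<omega> \<in> space (P N)" for \<omega>
      using trace_anticommutator_power[of "\<lambda>c. if c then A N \<omega> else B N \<omega>" \<omega> "2 * m"]
        assms(1,2)[of N] that by (simp add: X_def GOE_def)
    have "expectation (\<lambda>\<omega>. mat_trace (anticommutator (A N \<omega>) (B N \<omega>) ^\<^sub>m (2 * m))) =
        expectation (\<lambda>\<omega>. block_sum (2 * m) (\<lambda>w. trace_prod [w] \<omega>))"
      by (intro Bochner_Integration.integral_cong refl tr)
    also have "\<dots> = block_sum (2 * m) (\<lambda>w. T N [w])"
      unfolding T_def by (rule expectation_block_sum) (rule integrable_trace_prod)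
    finally show ?case
      by (simp add: divide_inverse block_sum_mult_right)
  qed
  ultimately have "(\<lambda>N. 1 / real N ^ (2 * m + 1) * prob_space.expectation (P N)
      (\<lambda>\<omega>. mat_trace (anticommutator (A N \<omega>) (B N \<omega>) ^\<^sub>m (2 * m)))) \<longlonglongrightarrow> moment_seq (2 * m)"
    by (rule Lim_transform_eventually)
  then show ?thesis by (simp only: moment_seq_formula[OF \<open>m \<ge> 1\<close>])
qed

end
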